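(* Let $D=2r+1\ge3$ be odd and let $n\ge D+1$. For every tree $T$ with $|V(T)|=n$ and $\operatorname{diam}(T)=D$, there exists a double spider $D_T$ with $n$ vertices and diameter $D$ such that $\lambda_2(T)\le\lambda_2(D_T)$, and such that if $\lambda_2(T)=\lambda_2(D_T)$ then $T$ itself is a double spider. Moreover, every double spider that maximizes $\lambda_2$ among all trees with $n$ vertices and diameter $D$ is a spider. In particular, every tree maximizing $\lambda_2$ among all trees with $n$ vertices and diameter $D$ is a spider.
   Context: Let $T=(V,E)$ be a finite tree with at least two vertices and let $\delta\Omega\subset V$ be its set of leaves, regarded as the boundary. For $g\colon\delta\Omega\to\mathbb R$, its harmonic extension $\widehat g$ is the unique function on $V$ with $\widehat g=g$ on $\delta\Omega$ and $\sum_{w\sim v}(\widehat g(v)-\widehat g(w))=0$ for every $v\in V\setminus\delta\Omega$. The first nonzero Steklov eigenvalue is $\lambda_2(T)=\min\{\sum_{xy\in E}(\widehat g(x)-\widehat g(y))^2/\sum_{\omega}g(\omega)^2 : g\in\mathbb R^{\delta\Omega}\setminus\{0\},\ \sum_\omega g(\omega)=0\}$. A spider is a tree obtained by taking $b\ge2$ paths of positive lengths and identifying one endpoint of each into a single common vertex, the paths being otherwise disjoint. A double spider $\operatorname{DS}(a_1,\dots,a_p;b_1,\dots,b_q)$ ($p,q\ge1$, $a_1\ge\dots\ge a_p\ge1$, $b_1\ge\dots\ge b_q\ge1$) is the tree obtained from two vertices $u,v$ joined by an edge by attaching at $u$ internally disjoint paths of lengths $a_1,\dots,a_p$ and at $v$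 internally disjoint paths of lengths $b_1,\dots,b_q$. *)

theory Defs
  imports Complex_Main "Graph_Theory.Graph_Theory"
begin

text \<open>
  A finite simple graph is a \<^locale>\<open>pair_graph\<close>: a finite loop-free digraph whose arc set is
  symmetric, so every undirected edge \<open>xy\<close> is represented by the two arcs \<open>(x, y)\<close> and \<open>(y, x)\<close>.
  The library constant \<open>tree\<close> is of no use here: for symmetric digraphs the library also counts the
  closed walk \<open>x, y, x\<close> as a cycle. The genuine cycles of a simple graph are those of length at
  least 3.
\<close>

definition tree_graph :: "'a pair_pre_digraph \<Rightarrow> bool" where
  "tree_graph G \<longleftrightarrow>
     pair_graph G \<and> connected (with_proj G) \<and>
     \<not> (\<exists>p. pre_digraph.cycle (with_proj G) p \<and> 3 \<le> length p)"

definition leaves :: "'a pair_pre_digraph \<Rightarrow> 'a set" where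
  "leaves G = {v \<in> pverts G. out_degree (with_proj G) v = 1}"

definition graph_dist :: "'a pair_pre_digraph \<Rightarrow> 'a \<Rightarrow> 'a \<Rightarrow> nat" where
  "graph_dist G u v = (LEAST k. \<exists>p. pre_digraph.awalk (with_proj G) u p v \<and> length p = k)"

definition graph_diam :: "'a pair_pre_digraph \<Rightarrow> nat" where
  "graph_diam G = Max {graph_dist G u v | u v. u \<in> pverts G \<and> v \<in> pverts G}"


text \<open>
  A boundary function is a total function of which only the values on \<^term>\<open>leaves G\<close> are used.
  Harmonic extensions live in \<^term>\<open>extensional (pverts G)\<close>, which makes a function on the vertex
  set a unique object.
\<close>

definition harmonic_extension :: "'a pair_pre_digraph \<Rightarrow> ('a \<Rightarrow> real) \<Rightarrow> 'a \<Rightarrow> real" where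
  "harmonic_extension G g =
     (THE h. h \<in> extensional (pverts G) \<and>
             (\<forall>\<omega>\<in>leaves G. h \<omega> = g \<omega>) \<and>
             (\<forall>v\<in>pverts G - leaves G. (\<Sum>w | (v, w) \<in> parcs G. h v - h w) = 0))"

text \<open>The factor one half is there because each edge contributes two arcs.\<close>

definition dirichlet_energy :: "'a pair_pre_digraph \<Rightarrow> ('a \<Rightarrow> real) \<Rightarrow> real" where
  "dirichlet_energy G h = (\<Sum>(x, y)\<in>parcs G. (h x - h y)\<^sup>2) / 2"

definition steklov_quotient :: "'a pair_pre_digraph \<Rightarrow> ('a \<Rightarrow> real) \<Rightarrow> real" where
  "steklov_quotient G g =
     dirichlet_energy G (harmonic_extension G g) / (\<Sum>\<omega>\<in>leaves G. (g \<omega>)\<^sup>2)"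

definition steklov_lambda2 :: "'a pair_pre_digraph \<Rightarrow> real" where
  "steklov_lambda2 G =
     (LEAST c. \<exists>g. (\<exists>\<omega>\<in>leaves G. g \<omega> \<noteq> 0) \<and> (\<Sum>\<omega>\<in>leaves G. g \<omega>) = 0 \<and>
                   c = steklov_quotient G g)"


text \<open>
  \<open>paths_at_root [l\<^sub>0, \<dots>, l\<^sub>k]\<close> consists of internally disjoint paths of lengths \<open>l\<^sub>0, \<dots>, l\<^sub>k\<close>
  starting at the common vertex \<^term>\<open>None\<close>; \<^term>\<open>Some (i, j)\<close> is the vertex of the \<open>i\<close>-th path at
  distance \<open>j + 1\<close> from \<^term>\<open>None\<close>.
\<close>

definition paths_at_root :: "nat list \<Rightarrow> (nat \<times> nat) option pair_pre_digraph" where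
  "paths_at_root ls =
     (let A = {(None, Some (i, 0)) | i. i < length ls \<and> 0 < ls ! i} \<union>
              {(Some (i, j), Some (i, Suc j)) | i j. i < length ls \<and> Suc j < ls ! i}
      in \<lparr> pverts = insert None {Some (i, j) | i j. i < length ls \<and> j < ls ! i},
           parcs = A \<union> A\<inverse> \<rparr>)"

definition spider :: "'a pair_pre_digraph \<Rightarrow> bool" where
  "spider G \<longleftrightarrow>
     (\<exists>ls. 2 \<le> length ls \<and> (\<forall>l\<in>set ls. 1 \<le> l) \<and>
           digraph_iso (with_proj (paths_at_root ls)) (with_proj G))"

text \<open>The two adjacent centres of \<open>DS as bs\<close> are \<^term>\<open>Inl None\<close> and \<^term>\<open>Inr None\<close>.\<close>

definition DS :: "nat list \<Rightarrow> nat list \<Rightarrow>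
    ((nat \<times> nat) option + (nat \<times> nat) option) pair_pre_digraph" where
  "DS as bs =
     \<lparr> pverts = Inl ` pverts (paths_at_root as) \<union> Inr ` pverts (paths_at_root bs),
       parcs = map_prod Inl Inl ` parcs (paths_at_root as) \<union>
               map_prod Inr Inr ` parcs (paths_at_root bs) \<union>
               {(Inl None, Inr None), (Inr None, Inl None)} \<rparr>"

definition double_spider :: "'a pair_pre_digraph \<Rightarrow> bool" where
  "double_spider G \<longleftrightarrow>
     (\<exists>as bs. 1 \<le> length as \<and> 1 \<le> length bs \<and>
              sorted_wrt (\<ge>) as \<and> sorted_wrt (\<ge>) bs \<and>
              (\<forall>a\<in>set as. 1 \<le> a) \<and> (\<forall>b\<in>set bs. 1 \<le> b) \<and>
              digraph_iso (with_proj (DS as bs)) (with_proj G))"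


text \<open>
  All competitors have their vertices in the same type \<^typ>\<open>'a\<close>. This is no restriction: as soon as
  there is one graph with \<open>n\<close> vertices in \<^typ>\<open>'a\<close>, every graph with \<open>n\<close> vertices has an isomorphic
  copy with vertices in \<^typ>\<open>'a\<close>.
\<close>

definition trees_with :: "nat \<Rightarrow> nat \<Rightarrow> 'a pair_pre_digraph set" where
  "trees_with n D = {T. tree_graph T \<and> card (pverts T) = n \<and> graph_diam T = D}"

definition maximizes_lambda2 :: "nat \<Rightarrow> nat \<Rightarrow> 'a pair_pre_digraph \<Rightarrow> bool" where
  "maximizes_lambda2 n D T \<longleftrightarrow>
     T \<in> trees_with n D \<and>
     (\<forall>T' :: 'a pair_pre_digraph. T' \<in> trees_with n D \<longrightarrow>
        steklov_lambda2 T' \<le> steklov_lambda2 T)"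

end

theory Submission
  imports Defs "HOL-Analysis.Analysis"
begin

text \<open>
  By the variational characterisation of the Steklov eigenvalue it suffices to find, for every tree
  \<open>T\<close> that is not a spider, a spider with the same number of vertices and the same diameter and
  strictly larger eigenvalue: spiders of diameter at least 3 are double spiders, so this yields all
  claims at once.

  Let \<open>cv\<close> be the central edge of \<open>T\<close>. Cut \<open>T\<close> into vertex-disjoint legs, one per leaf, giving
  priority to a longest path on either side of \<open>cv\<close>, and attach all legs to \<open>c\<close>, except that one
  leg of length \<open>r\<close> is first prolonged by \<open>cv\<close>. Let \<open>lam\<close> be the root of
  \<open>\<Sum> 1 / (1 - lam * l) = 0\<close> between \<open>1 / (r + 1)\<close> and \<open>1 / r\<close>, where \<open>l\<close> runs over the legs of this
  spider. Completing squares shows that the eigenvalue of the spider is at least \<open>lam\<close>. On \<open>T\<close>, let a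
  test function grow along each leg at the rate \<open>lam / (1 - lam * l)\<close> that it has on the spider,
  with opposite signs on the two sides of \<open>cv\<close>. A leg that is attached to any other vertex than \<open>c\<close> or \<open>v\<close>
  only increases the boundary values. If \<open>F\<close> and \<open>G\<close> are the sums of the rates on the two sides and \<open>\<phi>\<close> is
  the rate for a leg of length \<open>r\<close>, then \<open>F * G - (F + G) = (F - \<phi>) * (G - \<phi>) \<ge> 0\<close>, so the quotient
  of the test function is at most \<open>lam\<close>. Equality throughout forces all degrees but one to be at
  most 2.
\<close>

section \<open>Walks, distances and trees\<close>

text \<open>On a leg of length \<open>l\<close> that starts with value 1, an eigenfunction for
  \<open>lam\<close> is linear with slope \<open>s = lam * (1 + l * s)\<close>, so its leaf value is
  \<open>1 / (1 - lam * l)\<close>; zero boundary mean is then the equation for \<open>lam\<close>.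
  Such a leg adds \<open>l * s^2 - lam * (1 + l * s)^2 = - s\<close> to the energy minus
  \<open>lam\<close> times the boundary norm. On \<open>T\<close>, with values \<alpha> at
  \<open>c\<close> and -\<beta> at \<open>v\<close>, the claim becomes
  \<open>(\<alpha> + \<beta>)^2 \<le> \<alpha>^2 * F + \<beta>^2 * G\<close>, which holds for all
  \<alpha>, \<beta> iff \<open>1 / F + 1 / G \<le> 1\<close>. On the spider, the prolonged leg is
  the edge \<open>cv\<close> followed by a leg of length \<open>r\<close>, and the equation for
  \<open>lam\<close> reads \<open>1 / X + 1 / \<phi> = 1\<close>, with \<open>X\<close> the total
  rate of the other legs. The total \<open>F + G = X + \<phi>\<close> is the same for both trees. At
  fixed sum, with both parts at least \<phi>, the product is least at the split
  \<open>(X, \<phi>)\<close>, which is the spider. This requires a leg of length \<open>r\<close> on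
  either side of \<open>cv\<close>; odd diameter provides it. Neither eigenvalue is computed:
  \<open>lam\<close> merely separates them.\<close>

lemma pair_graph_iff:
  "pair_graph G \<longleftrightarrow>
     finite (pverts G) \<and> parcs G \<subseteq> pverts G \<times> pverts G \<and> sym (parcs G) \<and> irrefl (parcs G)"
  (is "?L \<longleftrightarrow> ?R")
proof
  assume ?L
  then interpret pair_graph G .
  show ?R
    using pair_finite_verts sym_arcs no_loops'
    by (auto simp: symmetric_def irrefl_def dest: in_arcsD1 in_arcsD2)
next
  assume R: ?R
  then have "finite (parcs G)"
    by (meson finite_SigmaI finite_subset)
  with R show ?L
    by unfold_locales (auto simp: symmetric_def irrefl_def)
qed

text \<open>Distances and connectivity depend only on the lengths of walks, so relational powers
  replace arc lists; the latter return only for cycles.\<close>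

lemma awalk_iff_relpow:
  assumes "parcs G \<subseteq> pverts G \<times> pverts G"
  shows "(\<exists>p. pre_digraph.awalk (with_proj G) u p v \<and> length p = k) \<longleftrightarrow>
         u \<in> pverts G \<and> (u, v) \<in> parcs G ^^ k"
proof (induction k arbitrary: u)
  case 0
  then show ?case
    by (auto simp: pre_digraph.awalk_def pre_digraph.cas.simps)
next
  case (Suc k)
  have "(\<exists>p. pre_digraph.awalk (with_proj G) u p v \<and> length p = Suc k) \<longleftrightarrow>
      u \<in> pverts G \<and> (\<exists>w. (u, w) \<in> parcs G \<and>
        (\<exists>p. pre_digraph.awalk (with_proj G) w p v \<and> length p = k))"
    (is "?L \<longleftrightarrow> ?R")
  proof
    assume ?L
    then obtain p where p: "pre_digraph.awalk (with_proj G) u p v" "length p = Suc k"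
      by blast
    then obtain e es where "p = e # es"
      by (cases p) auto
    with p assms show ?R
      by (cases e) (fastforce simp: pre_digraph.awalk_def pre_digraph.cas.simps)
  next
    assume ?R
    then obtain w p where "u \<in> pverts G" "(u, w) \<in> parcs G"
      "pre_digraph.awalk (with_proj G) w p v" "length p = k"
      by blast
    then have "pre_digraph.awalk (with_proj G) u ((u, w) # p) v \<and> length ((u, w) # p) = Suc k"
      by (auto simp: pre_digraph.awalk_def pre_digraph.cas.simps)
    then show ?L
      by blast
  qed
  also have "\<dots> \<longleftrightarrow> u \<in> pverts G \<and> (u, v) \<in> parcs G ^^ Suc k"
    unfolding Suc.IH using assms by (blast dest: relpow_Suc_D2 intro: relpow_Suc_I2)
  finally show ?case .
qed

lemma connected_with_proj_iff:
  assumes "pair_graph G"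
  shows "connected (with_proj G) \<longleftrightarrow>
    pverts G \<noteq> {} \<and> (\<forall>u\<in>pverts G. \<forall>v\<in>pverts G. (u, v) \<in> (parcs G)\<^sup>*)"
proof -
  interpret pair_graph G by fact
  have "u \<rightarrow>\<^sup>*\<^bsub>with_proj G\<^esub> v \<longleftrightarrow> (u, v) \<in> (parcs G)\<^sup>*" if "u \<in> pverts G" for u v
  proof -
    have "u \<rightarrow>\<^sup>*\<^bsub>with_proj G\<^esub> v \<longleftrightarrow> (\<exists>p. awalk u p v)"
      by (rule reachable_awalk)
    also have "\<dots> \<longleftrightarrow> (\<exists>k. (u, v) \<in> parcs G ^^ k)"
      using awalk_iff_relpow[of G u v] that assms by (auto simp: pair_graph_iff)
    finally show ?thesis
      by (simp add: rtrancl_is_UN_relpow)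
  qed
  moreover have "connected (with_proj G) \<longleftrightarrow> strongly_connected (with_proj G)"
    using symmetric_connected_imp_strongly_connected[OF sym_arcs] reachable_mk_symmetricI
    by (auto simp: connected_def strongly_connected_def)
  ultimately show ?thesis
    by (auto simp: strongly_connected_def)
qed

lemma graph_dist_eq:
  assumes "parcs G \<subseteq> pverts G \<times> pverts G" "u \<in> pverts G"
  shows "graph_dist G u v = (LEAST k. (u, v) \<in> parcs G ^^ k)"
  unfolding graph_dist_def using assms by (simp add: awalk_iff_relpow)

text \<open>Vertex lists are easier to build than arc lists. The length bound excludes going back
  and forth along one edge.\<close>

definition list_cycle :: "('a \<times> 'a) set \<Rightarrow> 'a list \<Rightarrow> bool" where
  "list_cycle E vs \<longleftrightarrow> 3 \<le> length vs \<and> distinct vs \<and>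
     successively (\<lambda>x y. (x, y) \<in> E) vs \<and> (last vs, hd vs) \<in> E"

lemma awalk_of_list:
  assumes "parcs G \<subseteq> pverts G \<times> pverts G" "u \<in> pverts G"
    "successively (\<lambda>x y. (x, y) \<in> parcs G) (u # vs)"
  shows "pre_digraph.awalk (with_proj G) u (zip (u # vs) vs) (last (u # vs)) \<and>
    pawalk_verts u (zip (u # vs) vs) = u # vs"
  using assms(2,3)
proof (induction vs arbitrary: u)
  case Nil
  then show ?case by (auto simp: pre_digraph.awalk_def pre_digraph.cas.simps)
next
  case (Cons w vs)
  have "w \<in> pverts G"
    using Cons assms(1) by auto
  with Cons show ?case
    by (auto simp: pre_digraph.awalk_def pre_digraph.cas.simps)
qed

lemma tree_graph_no_list_cycle:
  assumes "tree_graph G"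
  shows "\<not> list_cycle (parcs G) vs"
proof
  assume vs: "list_cycle (parcs G) vs"
  obtain u ws where ws: "vs = u # ws"
    using vs by (cases vs) (auto simp: list_cycle_def)
  have ne: "ws \<noteq> []"
    using vs ws by (auto simp: list_cycle_def)
  have E: "parcs G \<subseteq> pverts G \<times> pverts G"
    using assms by (auto simp: tree_graph_def pair_graph_iff)
  have u: "u \<in> pverts G"
    using vs ws E by (auto simp: list_cycle_def)
  have succ: "successively (\<lambda>x y. (x, y) \<in> parcs G) (u # ws @ [u])"
    using vs ws ne successively_append_iff[of "\<lambda>x y. (x, y) \<in> parcs G" "u # ws" "[u]"]
    by (auto simp: list_cycle_def)
  note W = awalk_of_list[OF E u succ]
  have "pre_digraph.cycle (with_proj G) (zip (u # ws @ [u]) (ws @ [u]))"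
    unfolding pre_digraph.cycle_def awalk_verts_with_proj_eq
    using W vs ws by (intro exI[of _ u]) (auto simp: list_cycle_def)
  moreover have "3 \<le> length (zip (u # ws @ [u]) (ws @ [u]))"
    using vs ws by (simp add: list_cycle_def)
  ultimately show False
    using assms by (auto simp: tree_graph_def)
qed

text \<open>A tree given by parents and depths. Depth drops along \<open>par\<close>, which excludes
  cycles and supports inductions; \<open>par c = c\<close> keeps all iterates of \<open>par\<close>
  inside \<open>V\<close>.\<close>

locale rooted =
  fixes V :: "'a set" and E :: "('a \<times> 'a) set" and c :: 'a
    and par :: "'a \<Rightarrow> 'a" and d :: "'a \<Rightarrow> nat"
  assumes finV: "finite V" and cV: "c \<in> V"
    and par_c: "par c = c" and d_c: "d c = 0"
    and par_V: "\<And>w. w \<in> V \<Longrightarrow> w \<noteq> c \<Longrightarrow> par w \<in> V"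
    and d_par: "\<And>w. w \<in> V \<Longrightarrow> w \<noteq> c \<Longrightarrow> d w = Suc (d (par w))"
    and E_eq: "E = (\<lambda>w. (w, par w)) ` (V - {c}) \<union> (\<lambda>w. (par w, w)) ` (V - {c})"

text \<open>Both ends move towards \<open>c\<close> one level at a time until they meet. The
  interior vertices are strictly nearer to \<open>c\<close> than the ends, which keeps the list
  distinct when a level is added and when a cycle is closed.\<close>

lemma same_level_path:
  fixes d :: "'a \<Rightarrow> nat"
  assumes sym: "sym E" and root: "\<And>w. w \<in> V \<Longrightarrow> d w = 0 \<Longrightarrow> w = c"
    and down: "\<And>w. w \<in> V \<Longrightarrow> d w > 0 \<Longrightarrow> \<exists>p\<in>V. (w, p) \<in> E \<and> d w = Suc (d p)"
    and "x \<in> V" "y \<in> V" "x \<noteq> y" "d x = k" "d y = k"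
  shows "\<exists>zs. zs \<noteq> [] \<and> distinct (x # zs @ [y]) \<and> (\<forall>z\<in>set zs. z \<in> V \<and> d z < k) \<and>
    successively (\<lambda>x y. (x, y) \<in> E) (x # zs @ [y])"
  using assms(4-)
proof (induction k arbitrary: x y)
  case 0
  then show ?case using root by metis
next
  case (Suc k)
  obtain p q where p: "p \<in> V" "(x, p) \<in> E" "d p = k" and q: "q \<in> V" "(y, q) \<in> E" "d q = k"
    using down[OF Suc.prems(1)] down[OF Suc.prems(2)] Suc.prems(4,5)
    by auto
  have qy: "(q, y) \<in> E"
    using q sym by (meson symD)
  show ?case
  proof (cases "p = q")
    case True
    show ?thesis
      using p q qy True Suc.prems by (intro exI[of _ "[p]"]) auto
  next
    case False
    obtain zs where zs: "zs \<noteq> []" "distinct (p # zs @ [q])" "\<forall>z\<in>set zs. z \<in> V \<and> d z < k"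
      "successively (\<lambda>x y. (x, y) \<in> E) (p # zs @ [q])"
      using Suc.IH[OF p(1) q(1) False p(3) q(3)] by blast
    have "successively (\<lambda>x y. (x, y) \<in> E) (x # (p # zs @ [q]) @ [y])"
      using zs p qy successively_append_iff[of "\<lambda>x y. (x, y) \<in> E" "p # zs @ [q]" "[y]"] by auto
    moreover have "distinct (x # (p # zs @ [q]) @ [y])"
      using zs p q Suc.prems by auto
    ultimately show ?thesis
      using zs p q by (intro exI[of _ "p # zs @ [q]"]) auto
  qed
qed

text \<open>Depth is the distance from \<open>c\<close>. An edge within one level, or two neighbours
  of a vertex on the level before, would be completed to a cycle by \<open>same_level_path\<close>.
  Hence parents are unique and every edge joins a vertex to its parent.\<close>

lemma rooted_of_acyclic:
  assumes fin: "finite V" and E: "E \<subseteq> V \<times> V" and sym: "sym E" and irr: "irrefl E"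
    and c: "c \<in> V" and conn: "\<And>w. w \<in> V \<Longrightarrow> (c, w) \<in> E\<^sup>*"
    and acyc: "\<And>vs. \<not> list_cycle E vs"
  shows "\<exists>par d. rooted V E c par d"
proof -
  define d where "d w = (LEAST k. (c, w) \<in> E ^^ k)" for w
  have dw: "(c, w) \<in> E ^^ d w" if "w \<in> V" for w
    using conn[OF that] unfolding d_def by (metis LeastI rtrancl_imp_relpow)
  have d_le: "d w \<le> k" if "(c, w) \<in> E ^^ k" for w k
    unfolding d_def using that by (rule Least_le)
  have d_c: "d c = 0"
    using d_le[of c 0] by simp
  have step: "d y \<le> Suc (d x)" if "(x, y) \<in> E" for x y
    using that E dw[of x] by (intro d_le) auto
  have root: "w = c" if "w \<in> V" "d w = 0" for w
    using dw[OF that(1)] that(2) by simp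
  have down: "\<exists>p\<in>V. (w, p) \<in> E \<and> d w = Suc (d p)" if w: "w \<in> V" "d w > 0" for w
  proof -
    obtain m where m: "d w = Suc m"
      using w by (cases "d w") auto
    obtain p where p: "(c, p) \<in> E ^^ m" "(p, w) \<in> E"
      using dw[OF w(1)] m by auto
    have "d p = m"
      using d_le[OF p(1)] step[OF p(2)] m by simp
    then show ?thesis
      using p m E sym by (meson SigmaD1 subsetD symD)
  qed
  have no_horizontal: "d x \<noteq> d y" if "(x, y) \<in> E" for x y
  proof
    assume eq: "d x = d y"
    have xy: "x \<in> V" "y \<in> V" "x \<noteq> y" "(y, x) \<in> E"
      using that E irr sym by (auto simp: irrefl_def dest: symD)
    obtain zs where "zs \<noteq> []" "distinct (x # zs @ [y])"
      "successively (\<lambda>x y. (x, y) \<in> E) (x # zs @ [y])"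
      using same_level_path[OF sym root down xy(1-3) eq refl] by blast
    then have "list_cycle E (x # zs @ [y])"
      using xy by (auto simp: list_cycle_def Suc_le_eq)
    then show False using acyc by blast
  qed
  have unique: "x = y" if "(w, x) \<in> E" "(w, y) \<in> E" "d w = Suc (d x)" "d w = Suc (d y)" for w x y
  proof (rule ccontr)
    assume "x \<noteq> y"
    have "x \<in> V" "y \<in> V" "d y = d x"
      using that E by auto
    then obtain zs where zs: "zs \<noteq> []" "distinct (x # zs @ [y])"
      "\<forall>z\<in>set zs. z \<in> V \<and> d z < d x" "successively (\<lambda>x y. (x, y) \<in> E) (x # zs @ [y])"
      using same_level_path[OF sym root down _ _ \<open>x \<noteq> y\<close> refl] by blast
    have "(y, w) \<in> E"
      using that sym by (meson symD)
    then have "list_cycle E (w # x # zs @ [y])"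
      using zs that by (auto simp: list_cycle_def)
    then show False using acyc by blast
  qed
  define par where "par w = (if w \<in> V \<and> w \<noteq> c then SOME p. p \<in> V \<and> (w, p) \<in> E \<and> d w = Suc (d p) else c)" for w
  have par: "par w \<in> V \<and> (w, par w) \<in> E \<and> d w = Suc (d (par w))" if "w \<in> V" "w \<noteq> c" for w
  proof -
    have "\<exists>p. p \<in> V \<and> (w, p) \<in> E \<and> d w = Suc (d p)"
      using down[of w] root[of w] that by blast
    from someI_ex[OF this] show ?thesis
      unfolding par_def using that by simp
  qed
  have "(x, y) \<in> (\<lambda>w. (w, par w)) ` (V - {c}) \<union> (\<lambda>w. (par w, w)) ` (V - {c})"
    if xy: "(x, y) \<in> E" for x y
  proof -
    have V: "x \<in> V" "y \<in> V" and yx: "(y, x) \<in> E"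
      using xy E sym by (auto dest: symD)
    consider "d x = Suc (d y)" | "d y = Suc (d x)"
      using step[OF xy] step[OF yx] no_horizontal[OF xy] by linarith
    then show ?thesis
    proof cases
      case 1
      then have "x \<noteq> c" using d_c by auto
      then have "y = par x"
        using unique[OF xy, of "par x"] par[of x] V 1 by auto
      then show ?thesis using V \<open>x \<noteq> c\<close> by auto
    next
      case 2
      then have "y \<noteq> c" using d_c by auto
      then have "x = par y"
        using unique[OF yx, of "par y"] par[of y] V 2 by auto
      then show ?thesis using V \<open>y \<noteq> c\<close> by auto
    qed
  qed
  moreover have "(w, par w) \<in> E \<and> (par w, w) \<in> E" if "w \<in> V" "w \<noteq> c" for w
    using par[OF that] sym by (meson symD)
  ultimately have "E = (\<lambda>w. (w, par w)) ` (V - {c}) \<union> (\<lambda>w. (par w, w)) ` (V - {c})"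
    by auto
  moreover have "par c = c"
    by (simp add: par_def)
  ultimately have "rooted V E c par d"
    using par fin c d_c by (simp add: rooted_def)
  then show ?thesis by blast
qed

lemma tree_graph_rooted:
  assumes "tree_graph G" "c \<in> pverts G"
  shows "\<exists>par d. rooted (pverts G) (parcs G) c par d"
proof (rule rooted_of_acyclic)
  have G: "pair_graph G"
    using assms by (simp add: tree_graph_def)
  then show "finite (pverts G)" "parcs G \<subseteq> pverts G \<times> pverts G" "sym (parcs G)" "irrefl (parcs G)"
    by (auto simp: pair_graph_iff)
  show "c \<in> pverts G" by fact
  show "(c, w) \<in> (parcs G)\<^sup>*" if "w \<in> pverts G" for w
    using assms that G connected_with_proj_iff[OF G] by (auto simp: tree_graph_def)
  show "\<not> list_cycle (parcs G) vs" for vs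
    using assms(1) by (rule tree_graph_no_list_cycle)
qed

section \<open>Rooted trees\<close>

definition nbrs :: "'a rel \<Rightarrow> 'a \<Rightarrow> 'a set" where
  "nbrs E v = {w. (v, w) \<in> E}"

lemma out_degree_with_proj: "out_degree (with_proj G) v = card (nbrs (parcs G) v)"
proof -
  have "out_arcs (with_proj G) v = Pair v ` nbrs (parcs G) v"
    by (auto simp: out_arcs_def nbrs_def)
  then show ?thesis
    by (simp add: out_degree_def card_image inj_on_def)
qed

lemma leaves_eq: "leaves G = {v \<in> pverts G. card (nbrs (parcs G) v) = 1}"
  by (simp add: leaves_def out_degree_with_proj)

lemma relpow_sym: "sym E \<Longrightarrow> (x, y) \<in> E ^^ k \<Longrightarrow> (y, x) \<in> E ^^ k"
proof (induction k arbitrary: y)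
  case (Suc k)
  then show ?case
    by (metis relpow_Suc_E relpow_Suc_I2 symD)
qed simp

text \<open>Yields lower bounds for distances. Integer values admit a potential that is negative on
  part of the tree.\<close>

lemma relpow_lipschitz:
  fixes f :: "'a \<Rightarrow> int"
  assumes "\<And>x y. (x, y) \<in> E \<Longrightarrow> f y \<le> f x + 1" "(x, y) \<in> E ^^ k"
  shows "f y \<le> f x + int k"
  using assms(2)
proof (induction k arbitrary: y)
  case (Suc k)
  then obtain z where "(x, z) \<in> E ^^ k" "(z, y) \<in> E"
    by auto
  then show ?case
    using Suc.IH[of z] assms(1)[of z y] by simp
qed simp

context rooted
begin

text \<open>The path from \<open>w\<close> to the root, both ends included; \<open>par c = c\<close>
  makes the unbounded range harmless.\<close>

definition anc :: "'a \<Rightarrow> 'a set" where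
  "anc w = range (\<lambda>k. (par ^^ k) w)"

definition children :: "'a \<Rightarrow> 'a set" where
  "children w = {x \<in> V - {c}. par x = w}"

lemma par_in_V: "w \<in> V \<Longrightarrow> par w \<in> V"
  using par_V par_c by (cases "w = c") auto

lemma d_par': "w \<in> V \<Longrightarrow> d (par w) = d w - 1"
  using d_par[of w] par_c d_c by (cases "w = c") auto

lemma d_eq_0_iff: "w \<in> V \<Longrightarrow> d w = 0 \<longleftrightarrow> w = c"
  using d_par[of w] d_c by fastforce

lemma par_neq: "w \<in> V \<Longrightarrow> w \<noteq> c \<Longrightarrow> par w \<noteq> w"
  using d_par[of w] by auto

lemma par_edge: "w \<in> V \<Longrightarrow> w \<noteq> c \<Longrightarrow> (w, par w) \<in> E" "w \<in> V \<Longrightarrow> w \<noteq> c \<Longrightarrow> (par w, w) \<in> E"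
  by (auto simp: E_eq)

lemma edge_cases:
  assumes "(x, y) \<in> E"
  obtains "x \<in> V" "x \<noteq> c" "y = par x" | "y \<in> V" "y \<noteq> c" "x = par y"
  using assms by (auto simp: E_eq)

lemma E_sub: "E \<subseteq> V \<times> V"
  by (auto simp: E_eq par_V)

lemma sym_E: "sym E"
  by (auto simp: E_eq sym_def)

lemma irrefl_E: "irrefl E"
  by (auto simp: E_eq irrefl_def dest: par_neq)

lemma funpow_V: "w \<in> V \<Longrightarrow> (par ^^ k) w \<in> V"
  by (induction k) (auto simp: par_in_V)

lemma d_funpow: "w \<in> V \<Longrightarrow> d ((par ^^ k) w) = d w - k"
  by (induction k) (auto simp: d_par' funpow_V)

lemma anc_sub: "w \<in> V \<Longrightarrow> anc w \<subseteq> V"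
  by (auto simp: anc_def funpow_V)

lemma finite_anc: "w \<in> V \<Longrightarrow> finite (anc w)"
  using anc_sub finV finite_subset by blast

lemma anc_refl [simp]: "w \<in> anc w"
  unfolding anc_def by (rule range_eqI[of _ _ 0]) simp

lemma anc_trans: "a \<in> anc b \<Longrightarrow> b \<in> anc w \<Longrightarrow> a \<in> anc w"
  unfolding anc_def by (auto simp: funpow_add[symmetric, THEN fun_cong, unfolded o_def] intro!: rangeI)

lemma par_anc [simp]: "par w \<in> anc w"
  unfolding anc_def by (rule range_eqI[of _ _ 1]) simp

lemma anc_par: "anc w = insert w (anc (par w))"
proof
  show "anc w \<subseteq> insert w (anc (par w))"
  proof
    fix a assume "a \<in> anc w"
    then obtain k where "a = (par ^^ k) w"
      by (auto simp: anc_def)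
    then show "a \<in> insert w (anc (par w))"
      by (cases k) (auto simp: anc_def funpow_swap1)
  qed
  show "insert w (anc (par w)) \<subseteq> anc w"
    using anc_trans par_anc by auto
qed

lemma funpow_root: "w \<in> V \<Longrightarrow> d w \<le> k \<Longrightarrow> (par ^^ k) w = c"
  using d_funpow d_eq_0_iff funpow_V by (metis diff_is_0_eq)

lemma ancE:
  assumes "w \<in> V" "a \<in> anc w"
  obtains k where "k \<le> d w" "a = (par ^^ k) w" "d a = d w - k"
proof -
  obtain k where k: "a = (par ^^ k) w"
    using assms by (auto simp: anc_def)
  show ?thesis
  proof (cases "k \<le> d w")
    case True
    then show ?thesis using that[of k] k assms d_funpow by auto
  next
    case False
    then show ?thesis
      using that[of "d w"] k assms funpow_root[of w k] funpow_root[of w "d w"] d_c by auto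
  qed
qed

lemma anc_depth: "w \<in> V \<Longrightarrow> a \<in> anc w \<Longrightarrow> a = (par ^^ (d w - d a)) w \<and> d a \<le> d w"
  by (elim ancE) auto

lemma root_anc: "w \<in> V \<Longrightarrow> c \<in> anc w"
  unfolding anc_def by (rule range_eqI[of _ _ "d w"]) (simp add: funpow_root)

lemma anc_depth_inj: "w \<in> V \<Longrightarrow> a \<in> anc w \<Longrightarrow> b \<in> anc w \<Longrightarrow> d a = d b \<Longrightarrow> a = b"
  using anc_depth by metis

lemma anc_level: "w \<in> V \<Longrightarrow> j \<le> d w \<Longrightarrow> \<exists>a\<in>anc w. d a = j"
  by (intro bexI[of _ "(par ^^ (d w - j)) w"]) (auto simp: d_funpow anc_def)

lemma anc_linear:
  assumes "w \<in> V" "a \<in> anc w" "b \<in> anc w" "d a \<le> d b"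
  shows "a \<in> anc b"
proof -
  have "a = (par ^^ (d w - d a)) w" "b = (par ^^ (d w - d b)) w" "d b \<le> d w"
    using assms anc_depth by auto
  moreover have "d w - d a = (d b - d a) + (d w - d b)"
    using assms calculation by simp
  ultimately have "a = (par ^^ (d b - d a)) b"
    by (metis funpow_add o_apply)
  then show ?thesis
    unfolding anc_def by (rule range_eqI)
qed

lemma card_anc: "w \<in> V \<Longrightarrow> card (anc w) = Suc (d w)"
proof -
  assume w: "w \<in> V"
  have "bij_betw d (anc w) {..d w}"
    using anc_depth_inj[OF w] anc_depth[OF w] anc_level[OF w]
    by (fastforce simp: bij_betw_def inj_on_def)
  then show ?thesis
    by (simp add: bij_betw_same_card)
qed

lemma walk_anc:
  assumes "w \<in> V" "a \<in> anc w"
  shows "(w, a) \<in> E ^^ (d w - d a)"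
proof -
  have "(w, (par ^^ k) w) \<in> E ^^ k" if "k \<le> d w" for k
    using that
  proof (induction k)
    case (Suc k)
    have "(par ^^ k) w \<noteq> c"
      using d_funpow[OF assms(1), of k] Suc.prems d_c by auto
    then show ?case
      using Suc par_edge(1)[OF funpow_V[OF assms(1)]] by auto
  qed simp
  from this[of "d w - d a"] show ?thesis
    using anc_depth[OF assms] by simp
qed

lemma walk_root: "w \<in> V \<Longrightarrow> (w, c) \<in> E ^^ d w"
  using walk_anc[OF _ root_anc, of w] d_c by simp

lemma d_edge: "(x, y) \<in> E \<Longrightarrow> d y \<le> Suc (d x)"
  by (erule edge_cases) (auto simp: d_par)

lemma d_walk: "(x, y) \<in> E ^^ k \<Longrightarrow> d y \<le> d x + k"
  using relpow_lipschitz[of E "int \<circ> d" x y k] d_edge by fastforce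

lemma walk_rtrancl: "x \<in> V \<Longrightarrow> y \<in> V \<Longrightarrow> (x, y) \<in> E\<^sup>*"
  using walk_root relpow_sym[OF sym_E walk_root] by (meson relpow_imp_rtrancl rtrancl_trans)

lemma nbrs_eq: "v \<in> V \<Longrightarrow> nbrs E v = children v \<union> (if v = c then {} else {par v})"
  by (auto simp: nbrs_def children_def E_eq)

lemma finite_children: "finite (children v)"
  by (rule finite_subset[OF _ finV]) (auto simp: children_def)

lemma par_notin_children: "v \<in> V \<Longrightarrow> v \<noteq> c \<Longrightarrow> par v \<notin> children v"
  using d_par[of v] d_par[of "par v"] by (auto simp: children_def)

lemma card_nbrs: "v \<in> V \<Longrightarrow> v \<noteq> c \<Longrightarrow> card (nbrs E v) = Suc (card (children v))"
  using par_notin_children finite_children by (simp add: nbrs_eq)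

lemma card_nbrs_root: "card (nbrs E c) = card (children c)"
  using cV by (simp add: nbrs_eq)

lemma leaf_iff: "v \<in> V \<Longrightarrow> v \<noteq> c \<Longrightarrow> card (nbrs E v) = 1 \<longleftrightarrow> children v = {}"
  using finite_children by (simp add: card_nbrs)

text \<open>A deepest vertex among those below \<open>a\<close> has no children.\<close>

lemma ex_leaf_below:
  assumes "a \<in> V"
  shows "\<exists>w\<in>V. children w = {} \<and> a \<in> anc w"
proof -
  have fin: "finite {w \<in> V. a \<in> anc w}" and ne: "{w \<in> V. a \<in> anc w} \<noteq> {}"
    using finV assms by auto
  obtain w where w: "w \<in> V" "a \<in> anc w" and max: "\<And>x. x \<in> V \<Longrightarrow> a \<in> anc x \<Longrightarrow> d x \<le> d w"
    using fin ne Max_in[of "d ` {w \<in> V. a \<in> anc w}"] Max_ge[of "d ` {w \<in> V. a \<in> anc w}"]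
    by (smt (verit) finite_imageI image_iff image_is_empty mem_Collect_eq)
  have "x \<notin> children w" for x
    using max[of x] w d_par[of x] anc_trans[OF w(2), of x] par_anc[of x]
    by (auto simp: children_def)
  then show ?thesis using w by blast
qed

text \<open>Both neighbours of a deepest vertex of the cycle would have to be its parent, although
  they are distinct.\<close>

lemma no_list_cycle:
  assumes "3 \<le> k" and edge: "\<And>i. i < k \<Longrightarrow> (x i, x (Suc i)) \<in> E" and "x k = x 0"
    and inj: "inj_on x {1..k}"
  shows False
proof -
  let ?D = "(\<lambda>i. d (x i)) ` {1..k}"
  have "Max ?D \<in> ?D"
    using \<open>3 \<le> k\<close> by (intro Max_in) simp_all
  then obtain i where i: "i \<in> {1..k}" "d (x i) = Max ?D"
    by fastforce
  then have max: "d (x j) \<le> d (x i)" if "j \<in> {1..k}" for j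
    using that by simp
  have down: "y = par (x i)" if "(x i, y) \<in> E" "d y \<le> d (x i)" for y
    using that by (elim edge_cases) (auto simp: d_par)
  \<comment> \<open>Predecessor and successor of \<open>x i\<close> with indices in
    \<open>{1..k}\<close>. The indices \<open>i = k\<close> and \<open>i = 1\<close> wrap around
    through \<open>x k = x 0\<close>; \<open>3 \<le> k\<close> keeps \<open>j\<close> and
    \<open>l\<close> apart.\<close>
  obtain j l where jl: "j \<in> {1..k}" "l \<in> {1..k}" "j \<noteq> l" "(x j, x i) \<in> E" "(x i, x l) \<in> E"
  proof -
    consider "i = k" | "i = 1" | "1 < i" "i < k"
      using i(1) by force
    then show ?thesis
    proof cases
      case 1
      then show ?thesis
        using that[of "k - 1" 1] edge[of "k - 1"] edge[of 0] assms by auto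
    next
      case 2
      then show ?thesis
        using that[of k 2] edge[of 0] edge[of 1] assms by (auto simp: numeral_2_eq_2)
    next
      case 3
      then show ?thesis
        using edge[of "i - 1"] edge[of i] by (intro that[of "i - 1" "Suc i"]) auto
    qed
  qed
  have "x j = x l"
    using down[OF symD[OF sym_E jl(4)] max[OF jl(1)]] down[OF jl(5) max[OF jl(2)]] by simp
  then show False
    using inj_onD[OF inj _ jl(1,2)] jl(3) by simp
qed

end

text \<open>Converse of \<open>tree_graph_rooted\<close>; it certifies that the constructed spider
  is a tree.\<close>

lemma rooted_tree_graph:
  assumes "rooted (pverts G) (parcs G) c par d"
  shows "tree_graph G"
proof -
  interpret rooted "pverts G" "parcs G" c par d by fact
  have G: "pair_graph G"
    using finV E_sub sym_E irrefl_E by (simp add: pair_graph_iff)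
  moreover have "connected (with_proj G)"
    unfolding connected_with_proj_iff[OF G] using cV walk_rtrancl by auto
  moreover have False if cyc: "pre_digraph.cycle (with_proj G) p" and len: "3 \<le> length p" for p
  proof -
    interpret G: pair_graph G by fact
    obtain u where aw: "G.awalk u p u" and dist: "distinct (tl (pawalk_verts u p))" and ne: "p \<noteq> []"
      using cyc unfolding G.cycle_def by auto
    let ?x = "\<lambda>i. pawalk_verts u p ! i"
    have len_x: "length (pawalk_verts u p) = Suc (length p)"
      using G.length_awalk_verts by simp
    have edge: "(pawalk_verts v q ! i, pawalk_verts v q ! Suc i) \<in> parcs G"
      if "G.awalk v q w" "i < length q" for v w q i
      using that
    proof (induction q arbitrary: v i)
      case (Cons e q)
      then show ?case
        by (cases i; cases e; cases q) (auto simp: G.awalk_Cons_iff)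
    qed simp
    show False
    proof (rule no_list_cycle[OF len, of ?x])
      have "last (pawalk_verts u p) = u" "hd (pawalk_verts u p) = u"
        using aw by auto
      then show "?x (length p) = ?x 0"
        using len_x by (metis G.awalk_verts_non_Nil diff_Suc_1 hd_conv_nth last_conv_nth)
      show "inj_on ?x {1..length p}"
      proof (rule inj_onI)
        fix i j assume ij: "i \<in> {1..length p}" "j \<in> {1..length p}" "?x i = ?x j"
        have "tl (pawalk_verts u p) ! (m - 1) = ?x m" if "m \<in> {1..length p}" for m
          using that len_x by (subst nth_tl) auto
        then have "tl (pawalk_verts u p) ! (i - 1) = tl (pawalk_verts u p) ! (j - 1)"
          using ij by simp
        then have "i - 1 = j - 1"
          using ij len_x dist by (subst (asm) nth_eq_iff_index_eq) auto
        then show "i = j"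
          using ij by auto
      qed
    qed (use edge[OF aw] in auto)
  qed
  ultimately show ?thesis
    by (auto simp: tree_graph_def)
qed

section \<open>Harmonic extensions\<close>

text \<open>This is \<open>dirichlet_energy\<close> on a bare arc relation, for use in locales over
  \<open>V\<close> and \<open>E\<close>.\<close>

definition energy :: "'a rel \<Rightarrow> ('a \<Rightarrow> real) \<Rightarrow> real" where
  "energy E h = (\<Sum>(x, y)\<in>E. (h x - h y)\<^sup>2) / 2"

text \<open>A product over the whole type with singleton factors outside \<open>V\<close>: it
  consists of extensional functions and is compact by Tychonoff.\<close>

definition box :: "'a set \<Rightarrow> real \<Rightarrow> ('a \<Rightarrow> real) set" where
  "box V M = PiE UNIV (\<lambda>v. if v \<in> V then {-M..M} else {undefined})"

lemma in_box_iff: "h \<in> box V M \<longleftrightarrow> h \<in> extensional V \<and> (\<forall>v\<in>V. \<bar>h v\<bar> \<le> M)"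
  by (auto simp: box_def PiE_iff extensional_def abs_le_iff minus_le_iff split: if_splits)

lemma compact_box: "compact (box V M)"
proof -
  have "compactin (product_topology (\<lambda>_. euclidean) UNIV) (box V M)"
    unfolding box_def compactin_PiE by simp
  then show ?thesis
    by (simp add: euclidean_product_topology compactin_euclidean_iff)
qed

lemma continuous_on_coordinate [continuous_intros]:
  "continuous_on S (\<lambda>h :: 'a \<Rightarrow> real. h v)"
  by (rule continuous_on_subset[OF continuous_on_product_coordinates subset_UNIV])

locale boundary_graph =
  fixes V L :: "'a set" and E :: "'a rel"
  assumes fin: "finite V" and E_sub: "E \<subseteq> V \<times> V" and sym_E: "sym E" and irrefl_E: "irrefl E"
    and L_sub: "L \<subseteq> V" and L_ne: "L \<noteq> {}"
    and conn: "\<And>x y. x \<in> V \<Longrightarrow> y \<in> V \<Longrightarrow> (x, y) \<in> E\<^sup>*"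
    and nbr: "\<And>v. v \<in> V - L \<Longrightarrow> {w. (v, w) \<in> E} \<noteq> {}"
begin

lemma fin_E: "finite E"
  using fin E_sub by (meson finite_SigmaI finite_subset)

lemma energy_nonneg: "0 \<le> energy E h"
  by (auto simp: energy_def intro!: sum_nonneg)

lemma energy_scale: "energy E (\<lambda>v. a * h v) = a\<^sup>2 * energy E h"
  by (simp add: energy_def sum_distrib_left right_diff_distrib[symmetric] power_mult_distrib
      case_prod_unfold)

definition lap :: "('a \<Rightarrow> real) \<Rightarrow> 'a \<Rightarrow> real" where
  "lap h v = (\<Sum>w | (v, w) \<in> E. h v - h w)"

definition harmonic_ext :: "('a \<Rightarrow> real) \<Rightarrow> ('a \<Rightarrow> real) \<Rightarrow> bool" where
  "harmonic_ext g h \<longleftrightarrow> h \<in> extensional V \<and> (\<forall>v\<in>L. h v = g v) \<and> (\<forall>v\<in>V - L. lap h v = 0)"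

lemma finite_nbrs: "finite {w. (v, w) \<in> E}"
  by (rule finite_subset[OF _ fin]) (use E_sub in auto)

lemma sum_E: "(\<Sum>(x, y)\<in>E. f x y) = (\<Sum>x\<in>V. \<Sum>y | (x, y) \<in> E. f x y)"
proof -
  have "E = (SIGMA x:V. {y. (x, y) \<in> E})"
    using E_sub by auto
  then show ?thesis
    using sum.Sigma[of V "\<lambda>x. {y. (x, y) \<in> E}" f] fin finite_nbrs by simp
qed

lemma sum_E_swap: "(\<Sum>(x, y)\<in>E. f x y) = (\<Sum>(x, y)\<in>E. f y x)"
  by (rule sum.reindex_bij_witness[of _ "\<lambda>(x, y). (y, x)" "\<lambda>(x, y). (y, x)"])
    (use sym_E in \<open>auto dest: symD\<close>)

text \<open>Discrete Green identity: expand one factor and reverse the arcs in one of the two sums.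
  The factor 2 reflects the two arcs per edge.\<close>

lemma green:
  fixes h k :: "'a \<Rightarrow> real"
  shows "(\<Sum>(x, y)\<in>E. (h x - h y) * (k x - k y)) = 2 * (\<Sum>x\<in>V. h x * lap k x)"
proof -
  have "(\<Sum>(x, y)\<in>E. (h x - h y) * (k x - k y)) =
      (\<Sum>(x, y)\<in>E. h x * (k x - k y)) + (\<Sum>(x, y)\<in>E. h y * (k y - k x))"
    by (simp add: sum.distrib[symmetric] case_prod_unfold algebra_simps)
  also have "(\<Sum>(x, y)\<in>E. h y * (k y - k x)) = (\<Sum>(x, y)\<in>E. h x * (k x - k y))"
    by (rule sum_E_swap)
  finally show ?thesis
    by (simp add: sum_E lap_def sum_distrib_left)
qed

lemma energy_add:
  "energy E (\<lambda>v. h v + k v) = energy E h + energy E k + 2 * (\<Sum>x\<in>V. k x * lap h x)"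
proof -
  have "((h x + k x) - (h y + k y))\<^sup>2 = (h x - h y)\<^sup>2 + (k x - k y)\<^sup>2
      + 2 * ((k x - k y) * (h x - h y))" for x y
    by (simp add: power2_eq_square algebra_simps)
  then have "(\<Sum>(x, y)\<in>E. ((h x + k x) - (h y + k y))\<^sup>2) =
      (\<Sum>(x, y)\<in>E. (h x - h y)\<^sup>2) + (\<Sum>(x, y)\<in>E. (k x - k y)\<^sup>2)
      + 2 * (\<Sum>(x, y)\<in>E. (k x - k y) * (h x - h y))"
    by (simp add: sum.distrib sum_distrib_left case_prod_unfold)
  then show ?thesis
    by (simp add: energy_def green)
qed

lemma energy_eq_lap: "energy E k = (\<Sum>x\<in>V. k x * lap k x)"
  using green[of k k] by (simp add: energy_def power2_eq_square)

text \<open>At each vertex one factor of the cross term vanishes: \<open>k\<close> on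
  \<open>L\<close>, \<open>lap h\<close> elsewhere. This orthogonality gives both the Dirichlet
  principle and uniqueness.\<close>

lemma energy_add_harmonic:
  assumes "harmonic_ext g h" "\<forall>v\<in>L. k v = 0"
  shows "energy E (\<lambda>v. h v + k v) = energy E h + energy E k"
proof -
  have "(\<Sum>x\<in>V. k x * lap h x) = 0"
    using assms by (force simp: harmonic_ext_def intro!: sum.neutral)
  then show ?thesis
    by (simp add: energy_add)
qed

lemma energy_0_const:
  assumes "energy E k = 0" "\<forall>v\<in>L. k v = 0" "x \<in> V"
  shows "k x = 0"
proof -
  have "(\<Sum>(x, y)\<in>E. (k x - k y)\<^sup>2) = 0"
    using assms(1) by (simp add: energy_def)
  then have eq: "k x = k y" if "(x, y) \<in> E" for x y
    using that fin_E by (subst (asm) sum_nonneg_eq_0_iff) auto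
  obtain y where "y \<in> L"
    using L_ne by auto
  then have "(x, y) \<in> E\<^sup>*" "k y = 0"
    using conn assms L_sub by auto
  then show ?thesis
    by (induction rule: converse_rtrancl_induct) (auto dest: eq)
qed

lemma harmonic_ext_le:
  assumes "harmonic_ext g h" "\<forall>v\<in>L. h' v = g v"
  shows "energy E h \<le> energy E h'"
proof -
  have "energy E h' = energy E (\<lambda>v. h v + (h' v - h v))"
    by simp
  also have "\<dots> = energy E h + energy E (\<lambda>v. h' v - h v)"
    using assms by (intro energy_add_harmonic) (auto simp: harmonic_ext_def)
  finally show ?thesis
    using energy_nonneg by simp
qed

lemma harmonic_ext_unique:
  assumes "harmonic_ext g h" "harmonic_ext g h'"
  shows "h = h'"
proof (rule extensionalityI)
  show "h \<in> extensional V" "h' \<in> extensional V"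
    using assms by (auto simp: harmonic_ext_def)
  fix v assume "v \<in> V"
  have "energy E h' = energy E (\<lambda>v. h v + (h' v - h v))"
    by simp
  also have "\<dots> = energy E h + energy E (\<lambda>v. h' v - h v)"
    using assms by (intro energy_add_harmonic) (auto simp: harmonic_ext_def)
  finally have "energy E (\<lambda>v. h' v - h v) \<le> 0"
    using harmonic_ext_le[OF assms(2), of h] assms(1) by (auto simp: harmonic_ext_def)
  then have "energy E (\<lambda>v. h' v - h v) = 0"
    using energy_nonneg by (simp add: order_antisym)
  then show "h v = h' v"
    using energy_0_const[of "\<lambda>v. h' v - h v" v] assms \<open>v \<in> V\<close> by (auto simp: harmonic_ext_def)
qed

text \<open>Replacing one value by the mean of its neighbours keeps the function in the box, so a
  minimiser of the energy over the box is harmonic even if some constraint is active.\<close>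

lemma harmonic_ext_exists:
  assumes "\<forall>v\<in>L. \<bar>g v\<bar> \<le> M"
  shows "\<exists>h\<in>box V M. harmonic_ext g h"
proof -
  define K where "K = box V M \<inter> (\<Inter>v\<in>L. {h. h v = g v})"
  have "M \<ge> 0"
    using assms L_ne by force
  have "compact K"
    unfolding K_def
    by (intro compact_Int_closed compact_box closed_INT ballI closed_Collect_eq continuous_intros)
  moreover have "(\<lambda>v. if v \<in> L then g v else if v \<in> V then 0 else undefined) \<in> K"
    using assms \<open>M \<ge> 0\<close> L_sub by (auto simp: K_def in_box_iff extensional_def)
  moreover have "continuous_on K (energy E)"
    unfolding energy_def case_prod_unfold by (intro continuous_intros) auto
  ultimately obtain h where h: "h \<in> K" and min: "\<And>k. k \<in> K \<Longrightarrow> energy E h \<le> energy E k"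
    using continuous_attains_inf[of K "energy E"] by blast
  have "lap h v = 0" if v: "v \<in> V - L" for v
  proof -
    define N where "N = {w. (v, w) \<in> E}"
    have N: "finite N" "N \<noteq> {}" "N \<subseteq> V"
      using nbr[OF v] finite_nbrs E_sub by (auto simp: N_def)
    have lap_eq: "lap h v = real (card N) * h v - (\<Sum>w\<in>N. h w)"
      by (simp add: lap_def N_def[symmetric] sum_subtractf)
    define t where "t = - lap h v / card N"
    have hv: "h v + t = (\<Sum>w\<in>N. h w) / card N"
      using N by (simp add: t_def lap_eq field_simps)
    have hbd: "\<bar>h w\<bar> \<le> M" if "w \<in> V" for w
      using h that by (simp add: K_def in_box_iff)
    have "\<bar>\<Sum>w\<in>N. h w\<bar> \<le> (\<Sum>w\<in>N. \<bar>h w\<bar>)"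
      by (rule sum_abs)
    also have "\<dots> \<le> card N * M"
      using sum_bounded_above[of N "\<lambda>w. \<bar>h w\<bar>" M] hbd N by auto
    finally have "\<bar>h v + t\<bar> \<le> M"
      unfolding hv using N by (simp add: field_simps card_gt_0_iff)
    then have "(\<lambda>x. h x + (if x = v then t else 0)) \<in> K"
      using h v by (auto simp: K_def in_box_iff extensional_def)
    from min[OF this] have "energy E h \<le> energy E (\<lambda>x. h x + (if x = v then t else 0))" .
    moreover have "energy E (\<lambda>x. h x + (if x = v then t else 0)) =
        energy E h + (\<Sum>x\<in>V. (if x = v then t else 0) * lap (\<lambda>x. if x = v then t else 0) x) +
        2 * (\<Sum>x\<in>V. (if x = v then t else 0) * lap h x)"
      by (simp only: energy_add energy_eq_lap[of "\<lambda>x. if x = v then t else 0"])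
    moreover have "(\<Sum>x\<in>V. (if x = v then t else 0) * lap k x) = t * lap k v" for k
      using v fin by (subst sum.remove[of _ v]) auto
    moreover have "lap (\<lambda>x. if x = v then t else 0) v = card N * t"
    proof -
      have "v \<notin> N"
        using irrefl_E by (auto simp: N_def irrefl_def)
      then have "(\<Sum>w\<in>N. t - (if w = v then t else 0)) = (\<Sum>w\<in>N. t)"
        by (intro sum.cong) auto
      then show ?thesis
        by (simp add: lap_def N_def)
    qed
    ultimately have "0 \<le> t * (card N * t) + 2 * (t * lap h v)"
      by simp
    \<comment> \<open>The linear gain is twice the quadratic cost, so moving to the mean strictly
      lowers the energy unless \<open>lap h v = 0\<close>.\<close>
    also have "\<dots> = - ((lap h v)\<^sup>2 / card N)"
      using N by (simp add: t_def field_simps power2_eq_square)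
    finally show ?thesis
      using N by (simp add: divide_le_0_iff)
  qed
  then show ?thesis
    using h by (intro bexI[of _ h]) (auto simp: K_def harmonic_ext_def in_box_iff)
qed

end

section \<open>Variational characterisation of the Steklov eigenvalue\<close>

lemma continuous_on_energy: "continuous_on S (energy E)"
  unfolding energy_def case_prod_unfold by (intro continuous_intros) auto

text \<open>Removes \<open>THE\<close> and \<open>LEAST\<close>: the eigenvalue is a minimum over
  all functions with zero boundary mean, harmonic or not. Part one serves the test function on
  \<open>T\<close>, part two supplies a minimiser on the spider. Two distinct leaves guarantee a
  nonzero competitor.\<close>

theorem steklov_lambda2_min:
  assumes bg: "boundary_graph (pverts G) (leaves G) (parcs G)"
    and ab: "a \<in> leaves G" "b \<in> leaves G" "a \<noteq> b"
  shows "\<And>h. (\<Sum>v\<in>leaves G. h v) = 0 \<Longrightarrow>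
      steklov_lambda2 G * (\<Sum>v\<in>leaves G. (h v)\<^sup>2) \<le> energy (parcs G) h"
    and "\<exists>h. (\<Sum>v\<in>leaves G. h v) = 0 \<and> (\<Sum>v\<in>leaves G. (h v)\<^sup>2) = 1 \<and>
      energy (parcs G) h = steklov_lambda2 G"
proof -
  interpret boundary_graph "pverts G" "leaves G" "parcs G" by fact
  define L where "L = leaves G"
  have fin_L: "finite L"
    using L_sub fin finite_subset by (auto simp: L_def)
  \<comment> \<open>Radius 1 suffices: boundary norm 1 bounds the leaf values by 1, and
    \<open>harmonic_ext_exists\<close> then gives an extension inside the box.\<close>
  define K where "K = box (pverts G) 1 \<inter> {h. (\<Sum>v\<in>L. h v) = 0} \<inter> {h. (\<Sum>v\<in>L. (h v)\<^sup>2) = 1}"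
  have "compact K"
    unfolding K_def
    by (intro compact_Int_closed compact_box closed_Collect_eq continuous_intros)
  moreover have "(\<lambda>v. if v \<in> pverts G then if v = a then 1 / sqrt 2 else if v = b then - 1 / sqrt 2 else 0
      else undefined) \<in> K" (is "?k \<in> K")
  proof -
    have L: "?k v = (if v = a then 1 / sqrt 2 else 0) - (if v = b then 1 / sqrt 2 else 0)"
      "(?k v)\<^sup>2 = (if v = a then 1 / 2 else 0) + (if v = b then 1 / 2 else 0)" if "v \<in> L" for v
      using that L_sub ab by (auto simp: L_def power_divide)
    have "(\<Sum>v\<in>L. ?k v) = 0" "(\<Sum>v\<in>L. (?k v)\<^sup>2) = 1"
      using L ab fin_L by (simp_all add: sum_subtractf sum.distrib L_def[symmetric])
    then show ?thesis
      using L_sub ab by (auto simp: K_def in_box_iff extensional_def)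
  qed
  ultimately obtain hm where hm: "hm \<in> K" and min: "\<And>k. k \<in> K \<Longrightarrow> energy (parcs G) hm \<le> energy (parcs G) k"
    using continuous_attains_inf[of K "energy (parcs G)"] continuous_on_energy by blast
  define m where "m = energy (parcs G) hm"
  have bound: "m * (\<Sum>v\<in>L. (h v)\<^sup>2) \<le> energy (parcs G) h" if h0: "(\<Sum>v\<in>L. h v) = 0" for h
  proof (cases "(\<Sum>v\<in>L. (h v)\<^sup>2) = 0")
    case True
    then show ?thesis using energy_nonneg by simp
  next
    case False
    define s where "s = sqrt (\<Sum>v\<in>L. (h v)\<^sup>2)"
    have s: "s > 0" "s\<^sup>2 = (\<Sum>v\<in>L. (h v)\<^sup>2)"
      using False by (auto simp: s_def sum_nonneg order_less_le)
    have "(h v)\<^sup>2 \<le> s\<^sup>2" if "v \<in> L" for v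
      unfolding s(2) using that fin_L by (intro member_le_sum) auto
    then have "\<bar>1 / s * h v\<bar> \<le> 1" if "v \<in> L" for v
      using s that abs_le_square_iff[of "h v" s] by (auto simp: field_simps)
    then obtain h' where h': "h' \<in> box (pverts G) 1" "harmonic_ext (\<lambda>v. 1 / s * h v) h'"
      using harmonic_ext_exists[of "\<lambda>v. 1 / s * h v" 1] by (auto simp: L_def)
    have eq: "h' v = 1 / s * h v" if "v \<in> L" for v
      using h' that by (simp add: harmonic_ext_def L_def)
    have "(\<Sum>v\<in>L. h' v) = 1 / s * (\<Sum>v\<in>L. h v)" "(\<Sum>v\<in>L. (h' v)\<^sup>2) = (\<Sum>v\<in>L. (h v)\<^sup>2) / s\<^sup>2"
      using eq by (simp_all add: sum_distrib_left sum_divide_distrib power_divide)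
    then have "h' \<in> K"
      using h' h0 s by (auto simp: K_def)
    then have "m \<le> energy (parcs G) h'"
      unfolding m_def by (rule min)
    also have "\<dots> \<le> energy (parcs G) (\<lambda>v. 1 / s * h v)"
      using h'(2) by (rule harmonic_ext_le) auto
    also have "\<dots> = energy (parcs G) h / s\<^sup>2"
      unfolding energy_scale by (simp add: power_divide)
    finally have "m * s\<^sup>2 \<le> energy (parcs G) h"
      using s(1) by (simp add: pos_le_divide_eq)
    then show ?thesis
      by (simp add: s(2))
  qed
  have ext: "harmonic_ext g (harmonic_extension G g)" for g
  proof -
    have "\<forall>v\<in>L. \<bar>g v\<bar> \<le> Max ((\<lambda>v. \<bar>g v\<bar>) ` L)"
      using fin_L by auto
    then obtain h where "harmonic_ext g h"
      using harmonic_ext_exists[of g] by (auto simp: L_def)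
    then have "\<exists>!h. harmonic_ext g h"
      using harmonic_ext_unique by blast
    then show ?thesis
      unfolding harmonic_extension_def harmonic_ext_def lap_def by (rule theI')
  qed
  have quot: "steklov_quotient G g = energy (parcs G) (harmonic_extension G g) / (\<Sum>v\<in>L. (g v)\<^sup>2)" for g
    by (simp add: steklov_quotient_def dirichlet_energy_def energy_def L_def)
  have hm0: "(\<Sum>v\<in>L. hm v) = 0" "(\<Sum>v\<in>L. (hm v)\<^sup>2) = 1"
    using hm by (auto simp: K_def)
  have "steklov_lambda2 G = m"
    unfolding steklov_lambda2_def
  proof (rule Least_equality)
    show "\<exists>g. (\<exists>\<omega>\<in>leaves G. g \<omega> \<noteq> 0) \<and> (\<Sum>\<omega>\<in>leaves G. g \<omega>) = 0 \<and> m = steklov_quotient G g"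
    proof (intro exI conjI)
      show "\<exists>\<omega>\<in>leaves G. hm \<omega> \<noteq> 0"
      proof (rule ccontr)
        assume "\<not> (\<exists>\<omega>\<in>leaves G. hm \<omega> \<noteq> 0)"
        then have "(\<Sum>v\<in>L. (hm v)\<^sup>2) = 0"
          by (simp add: L_def)
        then show False
          using hm0(2) by simp
      qed
      show "(\<Sum>\<omega>\<in>leaves G. hm \<omega>) = 0"
        using hm0 by (simp add: L_def)
      have eq: "harmonic_extension G hm v = hm v" if "v \<in> L" for v
        using ext[of hm] that by (auto simp: harmonic_ext_def L_def)
      \<comment> \<open>The minimiser \<open>hm\<close> is not known to be harmonic, but its
        harmonic extension has the same boundary values and, by the two bounds, the same
        energy.\<close>
      have "energy (parcs G) (harmonic_extension G hm) \<le> m"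
        unfolding m_def by (rule harmonic_ext_le[OF ext]) auto
      moreover have "m \<le> energy (parcs G) (harmonic_extension G hm)"
        using bound[of "harmonic_extension G hm"] hm0 eq by simp
      ultimately show "m = steklov_quotient G hm"
        unfolding quot hm0(2) by simp
    qed
  next
    fix y assume "\<exists>g. (\<exists>\<omega>\<in>leaves G. g \<omega> \<noteq> 0) \<and> (\<Sum>\<omega>\<in>leaves G. g \<omega>) = 0 \<and> y = steklov_quotient G g"
    then obtain g \<omega> where g: "\<omega> \<in> L" "g \<omega> \<noteq> 0" "(\<Sum>\<omega>\<in>L. g \<omega>) = 0" "y = steklov_quotient G g"
      by (auto simp: L_def)
    have "(\<Sum>v\<in>L. (g v)\<^sup>2) > 0"
      using g fin_L by (intro sum_pos2[of _ \<omega>]) auto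
    moreover have eq: "harmonic_extension G g v = g v" if "v \<in> L" for v
      using ext[of g] that by (auto simp: harmonic_ext_def L_def)
    ultimately show "m \<le> y"
      using bound[of "harmonic_extension G g"] g by (simp add: quot pos_le_divide_eq)
  qed
  then show "\<exists>h. (\<Sum>v\<in>leaves G. h v) = 0 \<and> (\<Sum>v\<in>leaves G. (h v)\<^sup>2) = 1 \<and>
      energy (parcs G) h = steklov_lambda2 G"
    and "\<And>h. (\<Sum>v\<in>leaves G. h v) = 0 \<Longrightarrow>
      steklov_lambda2 G * (\<Sum>v\<in>leaves G. (h v)\<^sup>2) \<le> energy (parcs G) h"
    using hm0 bound by (auto simp: L_def m_def)
qed

lemma rooted_boundary_graph:
  assumes "rooted (pverts G) (parcs G) c par d" "leaves G \<noteq> {}" "card (pverts G) \<ge> 2"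
  shows "boundary_graph (pverts G) (leaves G) (parcs G)"
proof -
  interpret rooted "pverts G" "parcs G" c par d by fact
  have "nbrs (parcs G) v \<noteq> {}" if v: "v \<in> pverts G" for v
  proof (cases "v = c")
    case True
    obtain w where w: "w \<in> pverts G" "w \<noteq> c"
      using assms(3) by (metis card_le_Suc0_iff_eq finV not_less_eq_eq numeral_2_eq_2 cV)
    obtain x where x: "x \<in> anc w" "d x = 1"
      using anc_level[OF w(1), of 1] w d_eq_0_iff by (metis One_nat_def Suc_leI gr0I)
    have xV: "x \<in> pverts G" "x \<noteq> c"
      using x w anc_sub d_c by auto
    then have "par x = c"
      using d_par[of x] x d_eq_0_iff par_V by auto
    then show ?thesis
      using xV True par_edge(2)[of x] by (auto simp: nbrs_def)
  next
    case False
    then show ?thesis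
      using par_edge(1)[OF v] by (auto simp: nbrs_def)
  qed
  then show ?thesis
    using finV E_sub sym_E irrefl_E walk_rtrancl assms(2)
    by unfold_locales (auto simp: leaves_def nbrs_def)
qed

section \<open>Isomorphisms, spiders and double spiders\<close>

text \<open>Arcs are pairs of vertices, so the vertex map alone determines the arc map that
  \<open>digraph_iso\<close> carries separately.\<close>

definition giso :: "('a \<Rightarrow> 'b) \<Rightarrow> 'a pair_pre_digraph \<Rightarrow> 'b pair_pre_digraph \<Rightarrow> bool" where
  "giso f G H \<longleftrightarrow> inj_on f (pverts G) \<and> pverts H = f ` pverts G \<and> parcs H = map_prod f f ` parcs G"

lemma digraph_iso_iff_giso:
  assumes "parcs G \<subseteq> pverts G \<times> pverts G"
  shows "digraph_iso (with_proj G) (with_proj H) \<longleftrightarrow> (\<exists>f. giso f G H)"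
proof
  assume "digraph_iso (with_proj G) (with_proj H)"
  then obtain f where f: "pre_digraph.digraph_isomorphism (with_proj G) f"
    and H: "with_proj H = app_iso f (with_proj G)"
    by (auto simp: digraph_iso_def)
  have V: "pverts H = iso_verts f ` pverts G" and A: "parcs H = iso_arcs f ` parcs G"
    and "fst = iso_tail f" "snd = iso_head f"
    using arg_cong[OF H, of verts] arg_cong[OF H, of arcs] arg_cong[OF H, of tail]
      arg_cong[OF H, of head] by simp_all
  then have arcs: "iso_arcs f a = map_prod (iso_verts f) (iso_verts f) a" if "a \<in> parcs G" for a
    using f that by (auto simp: pre_digraph.digraph_isomorphism_def prod_eq_iff)
  have "parcs H = map_prod (iso_verts f) (iso_verts f) ` parcs G"
    unfolding A using arcs by (rule image_cong[OF refl])
  then have "giso (iso_verts f) G H"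
    using f V by (simp add: giso_def pre_digraph.digraph_isomorphism_def)
  then show "\<exists>f. giso f G H"
    by (rule exI[where x = "iso_verts f"])
next
  assume "\<exists>f. giso f G H"
  then obtain f where f: "giso f G H" ..
  let ?f = "\<lparr>iso_verts = f, iso_arcs = map_prod f f, iso_head = snd, iso_tail = fst\<rparr>"
  have "wf_digraph (with_proj G)"
    using assms by unfold_locales auto
  moreover have "inj_on (map_prod f f) (parcs G)"
  proof (rule inj_on_subset[OF _ assms])
    show "inj_on (map_prod f f) (pverts G \<times> pverts G)"
      using f by (intro map_prod_inj_on) (simp_all add: giso_def)
  qed
  ultimately have "pre_digraph.digraph_isomorphism (with_proj G) ?f"
    using f by (auto simp: pre_digraph.digraph_isomorphism_def giso_def)
  moreover have "with_proj H = app_iso ?f (with_proj G)"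
    using f by (simp add: app_iso_def giso_def with_proj_def)
  ultimately show "digraph_iso (with_proj G) (with_proj H)"
    unfolding digraph_iso_def by blast
qed

lemma giso_trans: "giso f G H \<Longrightarrow> giso g H K \<Longrightarrow> giso (g \<circ> f) G K"
  by (auto simp: giso_def comp_inj_on image_comp map_prod_compose)

lemma giso_sym:
  assumes "parcs G \<subseteq> pverts G \<times> pverts G" "giso f G H"
  shows "giso (the_inv_into (pverts G) f) H G"
proof -
  have inv: "the_inv_into (pverts G) f (f x) = x" if "x \<in> pverts G" for x
    using assms that by (simp add: giso_def the_inv_into_f_f)
  have "inj_on (the_inv_into (pverts G) f) (pverts H)"
    using assms by (simp add: giso_def inj_on_the_inv_into)
  moreover have "the_inv_into (pverts G) f ` pverts H = pverts G"
    using assms inv by (force simp: giso_def image_iff)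
  moreover have "map_prod (the_inv_into (pverts G) f) (the_inv_into (pverts G) f) ` parcs H = parcs G"
  proof -
    have "map_prod (the_inv_into (pverts G) f) (the_inv_into (pverts G) f) ` parcs H = (\<lambda>x. x) ` parcs G"
      unfolding assms(2)[unfolded giso_def, THEN conjunct2, THEN conjunct2] image_image
      using assms(1) inv by (intro image_cong) auto
    then show ?thesis by simp
  qed
  ultimately show ?thesis
    by (simp add: giso_def)
qed

lemma graph_diam_image:
  "graph_diam G = Max ((\<lambda>(u, v). graph_dist G u v) ` (pverts G \<times> pverts G))"
  unfolding graph_diam_def by (rule arg_cong[of _ _ Max]) auto

context
  fixes G :: "'a pair_pre_digraph" and H :: "'b pair_pre_digraph" and f
  assumes G: "parcs G \<subseteq> pverts G \<times> pverts G" and f: "giso f G H"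
begin

lemma giso_parcs_sub: "parcs H \<subseteq> pverts H \<times> pverts H"
  using f G by (auto simp: giso_def)

lemma giso_arc:
  assumes xy: "x \<in> pverts G" "y \<in> pverts G"
  shows "(f x, f y) \<in> parcs H \<longleftrightarrow> (x, y) \<in> parcs G"
proof
  assume "(f x, f y) \<in> parcs H"
  then obtain a b where ab: "(a, b) \<in> parcs G" "f x = f a" "f y = f b"
    using f by (auto simp: giso_def)
  have inj: "inj_on f (pverts G)"
    using f by (simp add: giso_def)
  have "a \<in> pverts G" "b \<in> pverts G"
    using ab G by auto
  then show "(x, y) \<in> parcs G"
    using ab(1) inj_onD[OF inj ab(2)] inj_onD[OF inj ab(3)] xy by simp
next
  assume "(x, y) \<in> parcs G"
  then show "(f x, f y) \<in> parcs H"
    using f by (force simp: giso_def)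
qed

lemma giso_nbrs:
  assumes x: "x \<in> pverts G"
  shows "nbrs (parcs H) (f x) = f ` nbrs (parcs G) x"
proof
  show "nbrs (parcs H) (f x) \<subseteq> f ` nbrs (parcs G) x"
  proof
    fix y assume y: "y \<in> nbrs (parcs H) (f x)"
    then have "y \<in> f ` pverts G"
      using giso_parcs_sub f by (auto simp: nbrs_def giso_def)
    then obtain z where "z \<in> pverts G" "y = f z"
      by blast
    then show "y \<in> f ` nbrs (parcs G) x"
      using y giso_arc[OF x] by (auto simp: nbrs_def)
  qed
  show "f ` nbrs (parcs G) x \<subseteq> nbrs (parcs H) (f x)"
    using f by (force simp: nbrs_def giso_def)
qed

lemma giso_leaves: "leaves H = f ` leaves G"
proof -
  have inj: "inj_on f (pverts G)"
    using f by (simp add: giso_def)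
  have "card (nbrs (parcs H) (f x)) = card (nbrs (parcs G) x)" if "x \<in> pverts G" for x
  proof -
    have "nbrs (parcs G) x \<subseteq> pverts G"
      using G by (auto simp: nbrs_def)
    then show ?thesis
      unfolding giso_nbrs[OF that] by (rule card_image[OF inj_on_subset[OF inj]])
  qed
  moreover have "pverts H = f ` pverts G"
    using f by (simp add: giso_def)
  ultimately show ?thesis
    by (auto simp: leaves_eq)
qed

lemma giso_sum_leaves: "(\<Sum>v\<in>leaves H. h v) = (\<Sum>v\<in>leaves G. h (f v))"
proof -
  have "inj_on f (leaves G)"
    using f by (rule_tac inj_on_subset[of f "pverts G"]) (auto simp: giso_def leaves_eq)
  then show ?thesis
    unfolding giso_leaves by (simp add: sum.reindex)
qed

lemma giso_energy: "energy (parcs H) h = energy (parcs G) (\<lambda>v. h (f v))"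
proof -
  have "inj_on (map_prod f f) (pverts G \<times> pverts G)"
    using f by (intro map_prod_inj_on) (simp_all add: giso_def)
  then have "inj_on (map_prod f f) (parcs G)"
    using G by (rule inj_on_subset)
  moreover have "parcs H = map_prod f f ` parcs G"
    using f by (simp add: giso_def)
  ultimately show ?thesis
    by (simp add: energy_def sum.reindex case_prod_unfold)
qed

lemma giso_relpow:
  assumes "x \<in> pverts G" "y \<in> pverts G"
  shows "(f x, f y) \<in> parcs H ^^ k \<longleftrightarrow> (x, y) \<in> parcs G ^^ k"
  using assms(2)
proof (induction k arbitrary: y)
  case 0
  then show ?case
    using assms f by (auto simp: giso_def inj_on_def)
next
  case (Suc k)
  have "(f x, f y) \<in> parcs H ^^ Suc k \<longleftrightarrow> (\<exists>z\<in>pverts G. (f x, f z) \<in> parcs H ^^ k \<and> (f z, f y) \<in> parcs H)"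
  proof -
    have "pverts H = f ` pverts G"
      using f by (simp add: giso_def)
    then have "\<exists>w\<in>pverts G. z = f w" if "(z, y) \<in> parcs H" for z y
      using giso_parcs_sub that by blast
    then show ?thesis
      by auto
  qed
  also have "\<dots> \<longleftrightarrow> (\<exists>z\<in>pverts G. (x, z) \<in> parcs G ^^ k \<and> (z, y) \<in> parcs G)"
    using Suc giso_arc by blast
  also have "\<dots> \<longleftrightarrow> (x, y) \<in> parcs G ^^ Suc k"
    using G by auto
  finally show ?case .
qed

lemma giso_diam: "graph_diam H = graph_diam G"
proof -
  have V: "pverts H = f ` pverts G"
    using f by (simp add: giso_def)
  have dist: "graph_dist H (f u) (f v) = graph_dist G u v" if "u \<in> pverts G" "v \<in> pverts G" for u v
  proof -
    have "f u \<in> pverts H"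
      using that V by simp
    then show ?thesis
      by (simp add: graph_dist_eq[OF G that(1)] graph_dist_eq[OF giso_parcs_sub] giso_relpow[OF that])
  qed
  have "(\<lambda>(u, v). graph_dist H u v) ` (pverts H \<times> pverts H) =
      (\<lambda>(u, v). graph_dist H u v) ` (map_prod f f ` (pverts G \<times> pverts G))"
  proof -
    have "map_prod f f ` (pverts G \<times> pverts G) = pverts H \<times> pverts H"
      unfolding V by auto
    then show ?thesis
      by simp
  qed
  also have "\<dots> = (\<lambda>(u, v). graph_dist G u v) ` (pverts G \<times> pverts G)"
    unfolding image_image by (intro image_cong) (auto simp: dist)
  finally show ?thesis
    by (simp add: graph_diam_image)
qed

lemma giso_rooted:
  assumes "rooted (pverts G) (parcs G) c par d"
  shows "rooted (pverts H) (parcs H) (f c) (\<lambda>y. f (par (the_inv_into (pverts G) f y)))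
    (\<lambda>y. d (the_inv_into (pverts G) f y))"
proof -
  interpret rooted "pverts G" "parcs G" c par d by fact
  let ?g = "the_inv_into (pverts G) f"
  have inv: "?g (f x) = x" if "x \<in> pverts G" for x
    using f that by (simp add: giso_def the_inv_into_f_f)
  have V: "pverts H = f ` pverts G"
    using f by (simp add: giso_def)
  have Vc: "pverts H - {f c} = f ` (pverts G - {c})"
    using f cV by (auto simp: giso_def inj_on_def)
  have "parcs H = map_prod f f ` ((\<lambda>w. (w, par w)) ` (pverts G - {c}) \<union> (\<lambda>w. (par w, w)) ` (pverts G - {c}))"
    using f by (simp add: giso_def flip: E_eq)
  also have "\<dots> = (\<lambda>w. (w, f (par (?g w)))) ` (f ` (pverts G - {c})) \<union>
      (\<lambda>w. (f (par (?g w)), w)) ` (f ` (pverts G - {c}))"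
    unfolding image_Un image_image by (intro arg_cong2[of _ _ _ _ "(\<union>)"] image_cong) (auto simp: inv)
  finally have arcs: "parcs H = (\<lambda>w. (w, f (par (?g w)))) ` (pverts H - {f c}) \<union>
      (\<lambda>w. (f (par (?g w)), w)) ` (pverts H - {f c})"
    by (simp only: Vc)
  show ?thesis
  proof (rule rooted.intro)
    fix w assume "w \<in> pverts H" "w \<noteq> f c"
    then obtain x where x: "w = f x" "x \<in> pverts G" "x \<noteq> c"
      by (auto simp: V)
    then show "f (par (?g w)) \<in> pverts H" "d (?g w) = Suc (d (?g (f (par (?g w)))))"
      using d_par[of x] by (simp_all add: V inv par_V)
  qed (simp_all add: arcs V finV cV inv par_c d_c)
qed

end

text \<open>When both arc sets come from parent maps, commuting with these maps replaces any
  inspection of arcs.\<close>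

lemma gisoI_rooted:
  assumes "inj_on f (pverts G)" "pverts H = f ` pverts G" "c \<in> pverts G"
    "parcs G = (\<lambda>w. (w, par w)) ` (pverts G - {c}) \<union> (\<lambda>w. (par w, w)) ` (pverts G - {c})"
    "parcs H = (\<lambda>w. (w, par' w)) ` (pverts H - {f c}) \<union> (\<lambda>w. (par' w, w)) ` (pverts H - {f c})"
    "\<And>w. w \<in> pverts G \<Longrightarrow> w \<noteq> c \<Longrightarrow> f (par w) = par' (f w)"
  shows "giso f G H"
proof -
  have "pverts H - {f c} = f ` (pverts G - {c})"
    using assms(1-3) by (auto simp: inj_on_def)
  then have "parcs H = map_prod f f ` parcs G"
    unfolding assms(4,5) image_Un image_image using assms(6)
    by (intro arg_cong2[of _ _ _ _ "(\<union>)"]) (auto simp: image_image intro!: image_cong)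
  then show ?thesis
    using assms by (simp add: giso_def)
qed

section \<open>The standard spiders and double spiders described by parent maps\<close>

fun ppar :: "(nat \<times> nat) option \<Rightarrow> (nat \<times> nat) option" where
  "ppar None = None"
| "ppar (Some (i, 0)) = None"
| "ppar (Some (i, Suc j)) = Some (i, j)"

fun pdepth :: "(nat \<times> nat) option \<Rightarrow> nat" where
  "pdepth None = 0"
| "pdepth (Some (i, j)) = Suc j"

lemma pverts_paths: "pverts (paths_at_root ls) = insert None {Some (i, j) | i j. i < length ls \<and> j < ls ! i}"
  by (simp add: paths_at_root_def Let_def)

lemma pverts_paths_alt:
  "pverts (paths_at_root ls) = insert None (Some ` (SIGMA i:{..<length ls}. {..<ls ! i}))"
  by (auto simp: pverts_paths)

lemma pverts_paths_minus:
  "pverts (paths_at_root ls) - {None} = Some ` (SIGMA i:{..<length ls}. {..<ls ! i})"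
  by (auto simp: pverts_paths)

lemma parcs_paths:
  "parcs (paths_at_root ls) = (\<lambda>w. (w, ppar w)) ` (pverts (paths_at_root ls) - {None}) \<union>
     (\<lambda>w. (ppar w, w)) ` (pverts (paths_at_root ls) - {None})"
proof -
  define A where "A = {(None, Some (i, 0)) | i. i < length ls \<and> 0 < ls ! i} \<union>
              {(Some (i, j), Some (i, Suc j)) | i j. i < length ls \<and> Suc j < ls ! i}"
  have "A = (\<lambda>w. (ppar w, w)) ` (pverts (paths_at_root ls) - {None})" (is "_ = ?B")
  proof
    show "A \<subseteq> ?B"
      unfolding A_def pverts_paths_minus image_image
      by (force simp: image_iff)
    show "?B \<subseteq> A"
    proof
      fix e assume "e \<in> ?B"
      then obtain i j where "e = (ppar (Some (i, j)), Some (i, j))" "i < length ls" "j < ls ! i"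
        by (auto simp: pverts_paths_minus)
      then show "e \<in> A"
        by (cases j) (auto simp: A_def)
    qed
  qed
  moreover have "A\<inverse> = (\<lambda>w. (w, ppar w)) ` (pverts (paths_at_root ls) - {None})"
    unfolding calculation by (auto simp: image_iff)
  moreover have "parcs (paths_at_root ls) = A \<union> A\<inverse>"
    by (simp add: paths_at_root_def Let_def A_def)
  ultimately show ?thesis
    by blast
qed

lemma finite_paths: "finite (pverts (paths_at_root ls))"
  by (simp add: pverts_paths_alt)

lemma card_paths: "card (pverts (paths_at_root ls)) = Suc (sum_list ls)"
  unfolding pverts_paths_alt
  by (subst card_insert_disjoint) (auto simp: card_image sum_list_sum_nth atLeast0LessThan)

lemma None_in_paths: "None \<in> pverts (paths_at_root ls)"
  by (simp add: pverts_paths)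

lemma rooted_paths: "rooted (pverts (paths_at_root ls)) (parcs (paths_at_root ls)) None ppar pdepth"
proof (rule rooted.intro)
  fix w assume w: "w \<in> pverts (paths_at_root ls)" "w \<noteq> None"
  then obtain i j where ij: "w = Some (i, j)" "i < length ls" "j < ls ! i"
    by (auto simp: pverts_paths)
  then show "ppar w \<in> pverts (paths_at_root ls)"
    by (cases j) (auto simp: pverts_paths)
  show "pdepth w = Suc (pdepth (ppar w))"
    using ij by (cases j) auto
qed (simp_all add: finite_paths None_in_paths flip: parcs_paths)

lemma parcs_paths_sub: "parcs (paths_at_root ls) \<subseteq> pverts (paths_at_root ls) \<times> pverts (paths_at_root ls)"
  using rooted.E_sub[OF rooted_paths] .

lemma spider_iff: "spider G \<longleftrightarrow>
    (\<exists>ls f. 2 \<le> length ls \<and> (\<forall>l\<in>set ls. 1 \<le> l) \<and> giso f (paths_at_root ls) G)"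
  by (auto simp: spider_def digraph_iso_iff_giso[OF parcs_paths_sub])

text \<open>The order of the legs is immaterial. This allows a chosen leg to be moved to the front
  and the others to be sorted, as \<open>double_spider\<close> demands.\<close>

lemma giso_paths_permute:
  assumes "mset xs = mset ys"
  shows "\<exists>f. giso f (paths_at_root xs) (paths_at_root ys)"
proof -
  obtain p where p: "p permutes {..<length ys}" "permute_list p ys = xs"
    using assms mset_eq_permutation by blast
  have len: "length xs = length ys"
    using assms mset_eq_length by blast
  have nth: "xs ! i = ys ! p i" if "i < length xs" for i
    using p that len by (auto simp: permute_list_nth)
  have inj: "inj p"
    using p permutes_inj by blast
  have img: "p ` {..<length ys} = {..<length ys}"
    using p permutes_image by blast
  let ?f = "map_option (map_prod p id)"
  have "pverts (paths_at_root ys) = ?f ` pverts (paths_at_root xs)"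
  proof -
    have "(SIGMA i:{..<length ys}. {..<ys ! i}) = map_prod p id ` (SIGMA i:{..<length xs}. {..<xs ! i})"
    proof (intro set_eqI iffI; clarsimp)
      fix i j assume ij: "i < length ys" "j < ys ! i"
      then obtain i' where "i' < length ys" "i = p i'"
        using img by (metis (no_types, opaque_lifting) imageE lessThan_iff)
      then show "(i, j) \<in> map_prod p id ` (SIGMA i:{..<length xs}. {..<xs ! i})"
        using ij nth len by (intro image_eqI[of _ _ "(i', j)"]) auto
    next
      fix i j assume "i < length xs" "j < xs ! i"
      then show "p i < length ys \<and> j < ys ! p i"
        using img nth len by auto
    qed
    then show ?thesis
      unfolding pverts_paths_alt by (simp add: image_image)
  qed
  moreover have "inj ?f"
    using inj by (intro option.inj_map prod.inj_map) auto
  moreover have "?f (ppar w) = ppar (?f w)" for w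
    by (cases w rule: ppar.cases) auto
  ultimately have "giso ?f (paths_at_root xs) (paths_at_root ys)"
    using parcs_paths[of ys]
    by (intro gisoI_rooted[OF _ _ None_in_paths parcs_paths, where par' = ppar])
      (simp_all only: option.map, rule inj_on_subset[OF _ subset_UNIV])
  then show ?thesis
    by blast
qed

fun dpar :: "(nat \<times> nat) option + (nat \<times> nat) option \<Rightarrow> (nat \<times> nat) option + (nat \<times> nat) option" where
  "dpar (Inl x) = Inl (ppar x)"
| "dpar (Inr None) = Inl None"
| "dpar (Inr (Some x)) = Inr (ppar (Some x))"

lemma parcs_DS:
  "parcs (DS as bs) = (\<lambda>w. (w, dpar w)) ` (pverts (DS as bs) - {Inl None}) \<union>
     (\<lambda>w. (dpar w, w)) ` (pverts (DS as bs) - {Inl None})"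
proof -
  have V: "pverts (DS as bs) - {Inl None} = Inl ` (pverts (paths_at_root as) - {None}) \<union>
      Inr ` (pverts (paths_at_root bs) - {None}) \<union> {Inr None}"
    by (auto simp: DS_def pverts_paths)
  have [simp]: "w \<noteq> None \<Longrightarrow> dpar (Inr w) = Inr (ppar w)" for w
    by (cases w) auto
  show ?thesis
    unfolding V image_Un image_image
    by (subst DS_def, subst parcs_paths, subst parcs_paths)
       (auto simp: image_Un image_image image_iff)
qed

text \<open>The first vertex of leg 0 becomes the second centre and the rest of leg 0 the only leg
  attached there; the other leg indices drop by one.\<close>

fun spider_to_DS :: "(nat \<times> nat) option \<Rightarrow> (nat \<times> nat) option + (nat \<times> nat) option" where
  "spider_to_DS None = Inl None"
| "spider_to_DS (Some (0, 0)) = Inr None"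
| "spider_to_DS (Some (0, Suc j)) = Inr (Some (0, j))"
| "spider_to_DS (Some (Suc i, j)) = Inl (Some (i, j))"

lemma giso_DS: "giso spider_to_DS (paths_at_root (Suc l # as)) (DS as [l])"
proof -
  let ?P = "paths_at_root (Suc l # as)"
  have inj: "inj spider_to_DS"
  proof (rule injI)
    fix x y assume "spider_to_DS x = spider_to_DS y"
    then show "x = y"
      by (cases x rule: spider_to_DS.cases; cases y rule: spider_to_DS.cases) auto
  qed
  have img: "pverts (DS as [l]) = spider_to_DS ` pverts ?P"
  proof
    show "spider_to_DS ` pverts ?P \<subseteq> pverts (DS as [l])"
    proof
      fix y assume "y \<in> spider_to_DS ` pverts ?P"
      then obtain x where x: "x \<in> pverts ?P" "y = spider_to_DS x"
        by blast
      then show "y \<in> pverts (DS as [l])"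
        by (cases x rule: spider_to_DS.cases) (auto simp: pverts_paths DS_def)
    qed
    show "pverts (DS as [l]) \<subseteq> spider_to_DS ` pverts ?P"
    proof
      fix y assume y: "y \<in> pverts (DS as [l])"
      then consider "y = Inl None" | i j where "y = Inl (Some (i, j))" "i < length as" "j < as ! i"
        | "y = Inr None" | j where "y = Inr (Some (0, j))" "j < l"
        by (auto simp: DS_def pverts_paths)
      then show "y \<in> spider_to_DS ` pverts ?P"
      proof cases
        case 1
        then show ?thesis by (intro image_eqI[of _ _ None]) (auto simp: pverts_paths)
      next
        case 2
        then show ?thesis by (intro image_eqI[of _ _ "Some (Suc i, j)" for i j]) (auto simp: pverts_paths)
      next
        case 3
        then show ?thesis by (intro image_eqI[of _ _ "Some (0, 0)"]) (auto simp: pverts_paths)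
      next
        case 4
        then show ?thesis by (intro image_eqI[of _ _ "Some (0, Suc j)" for j]) (auto simp: pverts_paths)
      qed
    qed
  qed
  have comm: "spider_to_DS (ppar w) = dpar (spider_to_DS w)" for w
  proof (cases w rule: spider_to_DS.cases)
    case (3 j)
    then show ?thesis by (cases j) auto
  next
    case (4 i j)
    then show ?thesis by (cases j) auto
  qed auto
  show ?thesis
    using parcs_DS[of as "[l]"] inj img comm
    by (intro gisoI_rooted[OF _ _ None_in_paths parcs_paths, where par' = dpar])
      (simp_all only: spider_to_DS.simps, rule inj_on_subset[OF _ subset_UNIV])
qed

section \<open>The eigenvalue of a spider\<close>

lemma (in rooted) energy_rooted: "energy E h = (\<Sum>w\<in>V - {c}. (h w - h (par w))\<^sup>2)"
proof -
  let ?A = "(\<lambda>w. (w, par w)) ` (V - {c})" and ?B = "(\<lambda>w. (par w, w)) ` (V - {c})"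
  have disj: "?A \<inter> ?B = {}"
  proof -
    have "d (snd e) < d (fst e)" if "e \<in> ?A" for e
      using that d_par by force
    moreover have "d (fst e) < d (snd e)" if "e \<in> ?B" for e
      using that d_par by force
    ultimately show ?thesis
      by (meson disjoint_iff less_asym)
  qed
  have "(\<Sum>(x, y)\<in>E. (h x - h y)\<^sup>2) =
      (\<Sum>(x, y)\<in>?A. (h x - h y)\<^sup>2) + (\<Sum>(x, y)\<in>?B. (h x - h y)\<^sup>2)"
    unfolding E_eq using finV disj by (intro sum.union_disjoint) auto
  also have "(\<Sum>(x, y)\<in>?A. (h x - h y)\<^sup>2) = (\<Sum>w\<in>V - {c}. (h w - h (par w))\<^sup>2)"
    by (subst sum.reindex) (auto simp: inj_on_def)
  also have "(\<Sum>(x, y)\<in>?B. (h x - h y)\<^sup>2) = (\<Sum>w\<in>V - {c}. (h w - h (par w))\<^sup>2)"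
    by (subst sum.reindex) (auto simp: inj_on_def power2_commute)
  finally show ?thesis
    by (simp add: energy_def)
qed

text \<open>Positions on a leg start at 0, so \<open>ls ! i - 1\<close> is its end. With at least
  two legs, the centre is not a leaf.\<close>

lemma leaves_paths:
  assumes "2 \<le> length ls" "\<forall>l\<in>set ls. 1 \<le> l"
  shows "leaves (paths_at_root ls) = (\<lambda>i. Some (i, ls ! i - 1)) ` {..<length ls}"
proof -
  interpret rooted "pverts (paths_at_root ls)" "parcs (paths_at_root ls)" None ppar pdepth
    by (rule rooted_paths)
  have pos: "ls ! i > 0" if "i < length ls" for i
    using assms(2) that nth_mem by (metis less_eq_Suc_le One_nat_def)
  have mem: "x \<in> children w \<longleftrightarrow> (\<exists>i j. x = Some (i, j) \<and> i < length ls \<and> j < ls ! i \<and> ppar x = w)" for x w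
    unfolding children_def unfolding pverts_paths by auto
  have "children None = (\<lambda>i. Some (i, 0)) ` {..<length ls}"
  proof (intro set_eqI iffI)
    fix x assume "x \<in> children None"
    then obtain i j where "x = Some (i, j)" "i < length ls" "ppar (Some (i, j)) = None"
      by (auto simp: mem)
    then show "x \<in> (\<lambda>i. Some (i, 0)) ` {..<length ls}"
      by (cases j) auto
  qed (use pos in \<open>auto simp: mem\<close>)
  then have "card (children None) = length ls"
    by (simp add: card_image inj_on_def)
  then have N: "card (nbrs (parcs (paths_at_root ls)) None) \<noteq> 1"
    using assms(1) card_nbrs_root by simp
  have ch: "children (Some (i, j)) = (if Suc j < ls ! i then {Some (i, Suc j)} else {})"
    if "i < length ls" for i j
  proof (intro set_eqI iffI)
    fix x assume "x \<in> children (Some (i, j))"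
    then obtain i' j' where "x = Some (i', j')" "j' < ls ! i'" "ppar (Some (i', j')) = Some (i, j)"
      by (auto simp: mem)
    then show "x \<in> (if Suc j < ls ! i then {Some (i, Suc j)} else {})"
      by (cases j') auto
  qed (use that in \<open>auto simp: mem split: if_splits\<close>)
  have leaf: "card (nbrs (parcs (paths_at_root ls)) (Some (i, j))) = 1 \<longleftrightarrow> j = ls ! i - 1"
    if "i < length ls" "j < ls ! i" for i j
    using leaf_iff[of "Some (i, j)"] that ch[OF that(1)] by (auto simp: pverts_paths)
  show ?thesis
  proof (intro set_eqI iffI)
    fix x assume x: "x \<in> leaves (paths_at_root ls)"
    then obtain i j where "x = Some (i, j)" "i < length ls" "j < ls ! i"
      using N by (auto simp: leaves_eq pverts_paths)
    then show "x \<in> (\<lambda>i. Some (i, ls ! i - 1)) ` {..<length ls}"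
      using x leaf by (auto simp: leaves_eq)
  next
    fix x assume "x \<in> (\<lambda>i. Some (i, ls ! i - 1)) ` {..<length ls}"
    then obtain i where "i < length ls" "x = Some (i, ls ! i - 1)"
      by auto
    then show "x \<in> leaves (paths_at_root ls)"
      using leaf[of i "ls ! i - 1"] pos[of i] by (auto simp: leaves_eq pverts_paths)
  qed
qed

text \<open>Cauchy-Schwarz against the constant 1: linear interpolation minimises the energy of a
  path.\<close>

lemma path_energy_ge:
  fixes a :: "nat \<Rightarrow> real"
  assumes "0 < n"
  shows "(a n - a 0)\<^sup>2 / n \<le> (\<Sum>j<n. (a (Suc j) - a j)\<^sup>2)"
proof -
  have "(\<Sum>j<n. (a (Suc j) - a j) * 1)\<^sup>2 \<le> (\<Sum>j<n. (a (Suc j) - a j)\<^sup>2) * (\<Sum>j<n. 1\<^sup>2)"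
    by (rule Cauchy_Schwarz_ineq_sum)
  then show ?thesis
    using assms by (simp add: sum_lessThan_telescope pos_divide_le_eq)
qed

lemma energy_paths_ge:
  assumes "\<forall>l\<in>set ls. 1 \<le> l"
  shows "(\<Sum>i<length ls. (h (Some (i, ls ! i - 1)) - h None)\<^sup>2 / real (ls ! i)) \<le>
    energy (parcs (paths_at_root ls)) h"
proof -
  interpret rooted "pverts (paths_at_root ls)" "parcs (paths_at_root ls)" None ppar pdepth
    by (rule rooted_paths)
  have pos: "ls ! i > 0" if "i < length ls" for i
    using assms that nth_mem by (metis less_eq_Suc_le One_nat_def)
  have "energy (parcs (paths_at_root ls)) h =
      (\<Sum>p\<in>(SIGMA i:{..<length ls}. {..<ls ! i}). (h (Some p) - h (ppar (Some p)))\<^sup>2)"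
    unfolding energy_rooted pverts_paths_minus by (subst sum.reindex) auto
  also have "\<dots> = (\<Sum>i<length ls. \<Sum>j<ls ! i. (h (Some (i, j)) - h (ppar (Some (i, j))))\<^sup>2)"
    by (subst sum.Sigma) (auto simp: case_prod_unfold)
  finally have E: "energy (parcs (paths_at_root ls)) h =
    (\<Sum>i<length ls. \<Sum>j<ls ! i. (h (Some (i, j)) - h (ppar (Some (i, j))))\<^sup>2)" .
  show ?thesis
    unfolding E
  proof (rule sum_mono)
    fix i assume i: "i \<in> {..<length ls}"
    \<comment> \<open>The values along leg \<open>i\<close>, shifted by one so that the centre has
      index 0.\<close>
    define a where "a j = (case j of 0 \<Rightarrow> h None | Suc j \<Rightarrow> h (Some (i, j)))" for j
    have a: "(h (Some (i, j)) - h (ppar (Some (i, j))))\<^sup>2 = (a (Suc j) - a j)\<^sup>2" for j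
      by (cases j) (auto simp: a_def)
    have "h (Some (i, ls ! i - 1)) = a (ls ! i)" "h None = a 0"
      using pos[of i] i by (auto simp: a_def split: nat.split)
    then show "(h (Some (i, ls ! i - 1)) - h None)\<^sup>2 / real (ls ! i) \<le>
        (\<Sum>j<ls ! i. (h (Some (i, j)) - h (ppar (Some (i, j))))\<^sup>2)"
      unfolding a using path_energy_ge[of "ls ! i" a] pos[of i] i by simp
  qed
qed

text \<open>The right-hand side minus the left-hand side, expanded around the critical point
  \<open>g i = c / (1 - lam * l i)\<close>, is a quadratic form in the deviation with a single negative
  direction.\<close>

lemma spider_form_ge:
  fixes l g :: "'i \<Rightarrow> real" and lam c :: real
  assumes fin: "finite I" and z: "z \<in> I" and lam: "0 < lam"
    and l: "\<And>i. i \<in> I \<Longrightarrow> 0 < l i"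
    and neg: "1 < lam * l z" and pos: "\<And>i. i \<in> I - {z} \<Longrightarrow> lam * l i < 1"
    and crit: "(\<Sum>i\<in>I. 1 / (1 - lam * l i)) = 0"
    and g: "(\<Sum>i\<in>I. g i) = 0"
  shows "lam * (\<Sum>i\<in>I. (g i)\<^sup>2) \<le> (\<Sum>i\<in>I. (g i - c)\<^sup>2 / l i)"
proof -
  define k where "k i = 1 - lam * l i" for i
  define e where "e i = g i - c / k i" for i
  define J where "J = I - {z}"
  have J: "finite J" "I = insert z J" "z \<notin> J"
    using fin z by (auto simp: J_def)
  have k0: "k i \<noteq> 0" if "i \<in> I" for i
    using that neg pos[of i] by (cases "i = z") (auto simp: k_def)
  have kJ: "k i > 0" if "i \<in> J" for i
    using that pos[of i] by (auto simp: k_def J_def)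
  have crit': "(\<Sum>i\<in>I. 1 / k i) = 0"
    using crit by (simp add: k_def)
  have e0: "(\<Sum>i\<in>I. e i) = 0"
  proof -
    have "(\<Sum>i\<in>I. e i) = (\<Sum>i\<in>I. g i) - c * (\<Sum>i\<in>I. 1 / k i)"
      by (simp add: e_def sum_subtractf sum_distrib_left)
    then show ?thesis
      using g crit' by simp
  qed
  have expand: "(g i - c)\<^sup>2 / l i - lam * (g i)\<^sup>2 = k i / l i * (e i)\<^sup>2 - lam * c\<^sup>2 * (1 / k i)"
    if "i \<in> I" for i
  proof -
    have gi: "g i = e i + c / k i" and li: "l i = (1 - k i) / lam" and kk: "1 - k i \<noteq> 0"
      using lam l[OF that] by (auto simp: e_def k_def)
    show ?thesis
      unfolding gi li using k0[OF that] kk lam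
      by (simp add: divide_simps power2_eq_square) algebra
  qed
  have "(\<Sum>i\<in>I. (g i - c)\<^sup>2 / l i) - lam * (\<Sum>i\<in>I. (g i)\<^sup>2) =
      (\<Sum>i\<in>I. (g i - c)\<^sup>2 / l i - lam * (g i)\<^sup>2)"
    by (simp add: sum_subtractf sum_distrib_left)
  also have "\<dots> = (\<Sum>i\<in>I. k i / l i * (e i)\<^sup>2 - lam * c\<^sup>2 * (1 / k i))"
    by (intro sum.cong refl expand)
  also have "\<dots> = (\<Sum>i\<in>I. k i / l i * (e i)\<^sup>2) - lam * c\<^sup>2 * (\<Sum>i\<in>I. 1 / k i)"
    by (simp add: sum_subtractf sum_distrib_left)
  also have "\<dots> = (\<Sum>i\<in>J. k i / l i * (e i)\<^sup>2) - (- k z / l z) * (e z)\<^sup>2"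
    using J crit' by simp
  finally have key: "(\<Sum>i\<in>I. (g i - c)\<^sup>2 / l i) - lam * (\<Sum>i\<in>I. (g i)\<^sup>2) =
      (\<Sum>i\<in>J. k i / l i * (e i)\<^sup>2) - (- k z / l z) * (e z)\<^sup>2" .
  \<comment> \<open>As the deviations sum to 0, \<open>e z\<close> is minus their sum over
    \<open>J\<close>. Cauchy-Schwarz with weights \<open>k i / l i\<close> bounds it by the positive
    part of the form, and \<open>crit\<close> evaluates the sum of the inverse weights.\<close>
  have "(\<Sum>i\<in>J. e i)\<^sup>2 = (\<Sum>i\<in>J. (sqrt (k i / l i) * e i) * sqrt (l i / k i))\<^sup>2"
  proof -
    have "e i = (sqrt (k i / l i) * e i) * sqrt (l i / k i)" if "i \<in> J" for i
      using kJ[OF that] l[of i] that J by (simp add: real_sqrt_divide)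
    then show ?thesis
      by (metis (no_types, lifting) sum.cong)
  qed
  also have "\<dots> \<le> (\<Sum>i\<in>J. (sqrt (k i / l i) * e i)\<^sup>2) * (\<Sum>i\<in>J. (sqrt (l i / k i))\<^sup>2)"
    by (rule Cauchy_Schwarz_ineq_sum)
  also have "(\<Sum>i\<in>J. (sqrt (k i / l i) * e i)\<^sup>2) = (\<Sum>i\<in>J. k i / l i * (e i)\<^sup>2)"
    using kJ l J by (intro sum.cong refl) (simp add: power_mult_distrib less_imp_le)
  also have "(\<Sum>i\<in>J. (sqrt (l i / k i))\<^sup>2) = (\<Sum>i\<in>J. (1 / k i - 1) / lam)"
  proof (rule sum.cong[OF refl])
    fix i assume i: "i \<in> J"
    have "(sqrt (l i / k i))\<^sup>2 = l i / k i"
      using kJ[OF i] l[of i] i J by (simp add: less_imp_le)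
    also have "\<dots> = (1 / k i - 1) / lam"
      using kJ[OF i] lam by (simp add: k_def field_simps)
    finally show "(sqrt (l i / k i))\<^sup>2 = (1 / k i - 1) / lam" .
  qed
  also have "\<dots> = (- 1 / k z - card J) / lam"
    using J crit' by (simp add: sum_divide_distrib[symmetric] sum_subtractf)
  finally have cs: "(\<Sum>i\<in>J. e i)\<^sup>2 \<le> (\<Sum>i\<in>J. k i / l i * (e i)\<^sup>2) * ((- 1 / k z - card J) / lam)" .
  have kz: "k z < 0"
    using neg by (simp add: k_def)
  have Q: "0 \<le> (\<Sum>i\<in>J. k i / l i * (e i)\<^sup>2)"
    using kJ l J by (intro sum_nonneg mult_nonneg_nonneg) (auto intro!: divide_nonneg_nonneg less_imp_le)
  have lz: "l z > 0"
    using l z by blast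
  \<comment> \<open>Enlarging \<open>- card J\<close> to \<open>1\<close> suffices, because the
    right-hand side is exactly \<open>l z / (- k z)\<close>, the inverse of the coefficient of the
    negative term.\<close>
  have "(- 1 / k z - card J) / lam \<le> (1 - 1 / k z) / lam"
    using lam by (intro divide_right_mono) auto
  also have "\<dots> = l z / (- k z)"
    using kz lam by (simp add: k_def field_simps)
  finally have "(\<Sum>i\<in>J. e i)\<^sup>2 \<le> (\<Sum>i\<in>J. k i / l i * (e i)\<^sup>2) * (l z / (- k z))"
    using cs Q by (meson mult_left_mono order_trans)
  moreover have "e z = - (\<Sum>i\<in>J. e i)"
    using e0 J by simp
  ultimately have "(e z)\<^sup>2 \<le> (\<Sum>i\<in>J. k i / l i * (e i)\<^sup>2) * (l z / (- k z))"
    by simp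
  then have "(- k z / l z) * (e z)\<^sup>2 \<le> (- k z / l z) * ((\<Sum>i\<in>J. k i / l i * (e i)\<^sup>2) * (l z / (- k z)))"
    using kz lz by (intro mult_left_mono) (auto intro!: divide_nonpos_nonneg)
  also have "\<dots> = (\<Sum>i\<in>J. k i / l i * (e i)\<^sup>2)"
    using kz lz by simp
  finally show ?thesis
    using key by simp
qed

text \<open>The value \<open>h None\<close> at the centre is the free constant \<open>c\<close> of
  \<open>spider_form_ge\<close>; \<open>energy_paths_ge\<close> bounds the energy of each
  leg.\<close>

lemma steklov_bound_paths:
  fixes ls :: "nat list" and lam :: real
  assumes ls: "2 \<le> length ls" "\<forall>l\<in>set ls. 1 \<le> l" and lam: "0 < lam"
    and neg: "1 < lam * ls ! 0" and pos: "\<And>i. 0 < i \<Longrightarrow> i < length ls \<Longrightarrow> lam * ls ! i < 1"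
    and crit: "(\<Sum>i<length ls. 1 / (1 - lam * ls ! i)) = 0"
    and h: "(\<Sum>v\<in>leaves (paths_at_root ls). h v) = 0"
  shows "lam * (\<Sum>v\<in>leaves (paths_at_root ls). (h v)\<^sup>2) \<le> energy (parcs (paths_at_root ls)) h"
proof -
  have leaf_sum: "(\<Sum>v\<in>leaves (paths_at_root ls). f v) = (\<Sum>i<length ls. f (Some (i, ls ! i - 1)))"
    for f :: "_ \<Rightarrow> real"
    unfolding leaves_paths[OF ls] by (subst sum.reindex) (auto simp: inj_on_def)
  have "lam * (\<Sum>i<length ls. (h (Some (i, ls ! i - 1)))\<^sup>2) \<le>
      (\<Sum>i<length ls. (h (Some (i, ls ! i - 1)) - h None)\<^sup>2 / real (ls ! i))"
  proof (rule spider_form_ge[where z = 0])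
    show "0 < real (ls ! i)" if "i \<in> {..<length ls}" for i
    proof -
      have "ls ! i \<in> set ls"
        using that by simp
      then have "1 \<le> ls ! i"
        using ls(2) by blast
      then show ?thesis
        by simp
    qed
    show "lam * real (ls ! i) < 1" if "i \<in> {..<length ls} - {0}" for i
      using that pos by simp
    show "0 \<in> {..<length ls}"
      using ls(1) by auto
    show "(\<Sum>i<length ls. h (Some (i, ls ! i - 1))) = 0"
      using h leaf_sum by simp
  qed (use lam neg crit in simp_all)
  also have "\<dots> \<le> energy (parcs (paths_at_root ls)) h"
    using ls(2) by (rule energy_paths_ge)
  finally show ?thesis
    by (simp add: leaf_sum)
qed

section \<open>Distances and diameters of spiders\<close>

lemma graph_dist_le:
  assumes "parcs G \<subseteq> pverts G \<times> pverts G" "u \<in> pverts G" "(u, v) \<in> parcs G ^^ k"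
  shows "graph_dist G u v \<le> k"
  using assms by (simp add: graph_dist_eq Least_le)

lemma graph_diam_le:
  assumes fin: "finite (pverts G)" and ne: "pverts G \<noteq> {}" and sub: "parcs G \<subseteq> pverts G \<times> pverts G"
    and le: "\<And>x y. x \<in> pverts G \<Longrightarrow> y \<in> pverts G \<Longrightarrow> \<exists>k\<le>D. (x, y) \<in> parcs G ^^ k"
  shows "graph_diam G \<le> D"
proof -
  have "graph_dist G x y \<le> D" if "x \<in> pverts G" "y \<in> pverts G" for x y
    using le[OF that] graph_dist_le[OF sub that(1)] by (meson order_trans)
  then show ?thesis
    unfolding graph_diam_image using fin ne by (subst Max_le_iff) auto
qed

lemma graph_dist_le_diam:
  assumes "finite (pverts G)" "x \<in> pverts G" "y \<in> pverts G"
  shows "graph_dist G x y \<le> graph_diam G"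
  unfolding graph_diam_image using assms by (intro Max_ge) (auto intro!: image_eqI[of _ _ "(x, y)"])

lemma graph_diam_attained:
  assumes "finite (pverts G)" "pverts G \<noteq> {}"
  obtains x y where "x \<in> pverts G" "y \<in> pverts G" "graph_dist G x y = graph_diam G"
proof -
  have "Max ((\<lambda>(u, v). graph_dist G u v) ` (pverts G \<times> pverts G)) \<in>
      (\<lambda>(u, v). graph_dist G u v) ` (pverts G \<times> pverts G)"
    using assms by (intro Max_in) simp_all
  then show ?thesis
    using that unfolding graph_diam_image by auto
qed

lemma (in rooted) walk_via_root:
  assumes "x \<in> V" "y \<in> V"
  shows "(x, y) \<in> E ^^ (d x + d y)"
  using walk_root[OF assms(1)] relpow_sym[OF sym_E walk_root[OF assms(2)]]
  by (auto simp: relpow_add)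

lemma graph_diam_paths_le_2:
  assumes "\<forall>l\<in>set ls. l \<le> 1"
  shows "graph_diam (paths_at_root ls) \<le> 2"
proof (rule graph_diam_le[OF finite_paths _ parcs_paths_sub])
  interpret rooted "pverts (paths_at_root ls)" "parcs (paths_at_root ls)" None ppar pdepth
    by (rule rooted_paths)
  have "pdepth x \<le> 1" if x: "x \<in> pverts (paths_at_root ls)" for x
  proof (cases x)
    case (Some p)
    then obtain i j where "x = Some (i, j)" "i < length ls" "j < ls ! i"
      using x by (auto simp: pverts_paths)
    moreover have "ls ! i \<le> 1"
      using assms calculation(2) nth_mem by blast
    ultimately show ?thesis
      by simp
  qed simp
  then show "\<exists>k\<le>2. (x, y) \<in> parcs (paths_at_root ls) ^^ k"
    if "x \<in> pverts (paths_at_root ls)" "y \<in> pverts (paths_at_root ls)" for x y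
    using walk_via_root[OF that] that by (metis add_mono one_add_one)
qed (use None_in_paths in auto)

text \<open>Some leg has length at least 2, since otherwise the diameter would be at most 2. Its
  vertex next to the centre serves as second centre, with a single leg of length
  \<open>l - 1\<close>.\<close>

lemma spider_imp_double_spider:
  assumes "spider G" "3 \<le> graph_diam G"
  shows "double_spider G"
proof -
  obtain ls f where ls: "2 \<le> length ls" "\<forall>l\<in>set ls. 1 \<le> l" and f: "giso f (paths_at_root ls) G"
    using assms(1) spider_iff by blast
  have "3 \<le> graph_diam (paths_at_root ls)"
    using assms(2) giso_diam[OF parcs_paths_sub f] by simp
  then have "\<not> (\<forall>l\<in>set ls. l \<le> 1)"
    using graph_diam_paths_le_2 by fastforce
  then obtain l where l: "l \<in> set ls" "l \<ge> 2"
    by force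
  define as where "as = rev (sort (remove1 l ls))"
  have ms: "mset (l # as) = mset ls"
    using l by (simp add: as_def)
  have "length ls = Suc (length as)"
    using ms by (metis length_Cons mset_eq_length)
  then have as: "1 \<le> length as" "sorted_wrt (\<ge>) as" "\<forall>a\<in>set as. 1 \<le> a"
    using ls ms by (auto simp: as_def sorted_wrt_rev dest: notin_set_remove1)
  obtain p where p: "giso p (paths_at_root (l # as)) (paths_at_root ls)"
    using giso_paths_permute[OF ms] by blast
  have "Suc (l - 1) = l"
    using l by simp
  then have "giso spider_to_DS (paths_at_root (l # as)) (DS as [l - 1])"
    using giso_DS[of "l - 1" as] by simp
  note D = giso_sym[OF parcs_paths_sub this] giso_parcs_sub[OF parcs_paths_sub this]
  have "\<exists>g. giso g (DS as [l - 1]) G"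
    using giso_trans[OF giso_trans[OF D(1) p] f] by blast
  then have "digraph_iso (with_proj (DS as [l - 1])) (with_proj G)"
    using digraph_iso_iff_giso[OF D(2)] by blast
  then show ?thesis
    unfolding double_spider_def using as l
    by (intro exI[of _ as] exI[of _ "[l - 1]"]) auto
qed

lemma graph_diam_paths:
  assumes "1 \<le> r" "\<forall>l\<in>set ls. l \<le> r"
  shows "graph_diam (paths_at_root (Suc r # r # ls)) = 2 * r + 1"
proof (rule antisym)
  let ?P = "paths_at_root (Suc r # r # ls)"
  interpret rooted "pverts ?P" "parcs ?P" None ppar pdepth
    by (rule rooted_paths)
  have depth: "pdepth x \<le> r \<or> x = Some (0, r)" if x: "x \<in> pverts ?P" for x
  proof (cases x)
    case (Some p)
    then obtain i j where ij: "x = Some (i, j)" "i < length (Suc r # r # ls)" "j < (Suc r # r # ls) ! i"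
      using x by (auto simp: pverts_paths)
    show ?thesis
    proof (cases i)
      case 0
      then show ?thesis using ij by auto
    next
      case (Suc i')
      then have "(Suc r # r # ls) ! i \<in> set (r # ls)"
        using ij(2) nth_mem[of i' "r # ls"] by simp
      then have "(Suc r # r # ls) ! i \<le> r"
        using assms(2) by auto
      then show ?thesis
        using ij by simp
    qed
  qed simp
  show "graph_diam ?P \<le> 2 * r + 1"
  proof (rule graph_diam_le[OF finite_paths _ parcs_paths_sub])
    fix x y assume xy: "x \<in> pverts ?P" "y \<in> pverts ?P"
    \<comment> \<open>Only \<open>Some (0, r)\<close> has depth \<open>Suc r\<close>. A walk through
      the centre is too long only if both ends are this vertex, and then the empty walk
      does.\<close>
    show "\<exists>k\<le>2 * r + 1. (x, y) \<in> parcs ?P ^^ k"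
    proof (cases "x = Some (0, r) \<and> y = Some (0, r)")
      case True
      then show ?thesis
        by (intro exI[of _ 0]) auto
    next
      case False
      then have "pdepth x + pdepth y \<le> 2 * r + 1"
        using depth[OF xy(1)] depth[OF xy(2)] by auto
      then show ?thesis
        using walk_via_root[OF xy] by blast
    qed
  qed (use None_in_paths in auto)
  \<comment> \<open>Signed depth, positive exactly on the long leg: it changes by at most 1 per arc
    and differs by \<open>2 * r + 1\<close> between the ends of the first two legs.\<close>
  define f where "f x = (case x of Some (0, j) \<Rightarrow> int j + 1 | _ \<Rightarrow> - int (pdepth x))" for x
  let ?x = "Some (1, r - 1)" and ?y = "Some (0, r)"
  have f_par: "\<bar>f w - f (ppar w)\<bar> \<le> 1" for w
    by (cases w rule: ppar.cases) (auto simp: f_def split: nat.split)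
  have V: "?x \<in> pverts ?P" "?y \<in> pverts ?P"
    using assms(1) by (auto simp: pverts_paths)
  have lip: "f y \<le> f x + 1" if "(x, y) \<in> parcs ?P" for x y
    using that
  proof (cases rule: edge_cases)
    case 1
    then show ?thesis using f_par[of x] by simp
  next
    case 2
    then show ?thesis using f_par[of y] by simp
  qed
  have "(?x, ?y) \<in> parcs ?P ^^ graph_dist ?P ?x ?y"
    unfolding graph_dist_eq[OF parcs_paths_sub V(1)]
    using walk_via_root[OF V] by (rule LeastI)
  from relpow_lipschitz[of "parcs ?P" f, OF lip this] have "2 * r + 1 \<le> graph_dist ?P ?x ?y"
    using assms(1) by (simp add: f_def)
  also have "\<dots> \<le> graph_diam ?P"
    using finite_paths V by (rule graph_dist_le_diam)
  finally show "2 * r + 1 \<le> graph_diam ?P" .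
qed

text \<open>A bijection moves the standard spider onto \<open>V\<close>, so that it lives in the
  type of the competitors. A minimiser on the copy, pulled back, is subject to
  \<open>steklov_bound_paths\<close>.\<close>

lemma ex_spider_lambda2_ge:
  fixes V :: "'a set" and lam :: real
  assumes V: "finite V" "card V = Suc (sum_list (Suc r # r # ls))"
    and r: "1 \<le> r" and ls: "\<forall>l\<in>set ls. 1 \<le> l \<and> l \<le> r"
    and lam: "0 < lam" "1 < lam * Suc r" "lam * r < 1"
    and crit: "(\<Sum>l\<leftarrow>Suc r # r # ls. 1 / (1 - lam * real l)) = 0"
  shows "\<exists>S :: 'a pair_pre_digraph. spider S \<and> tree_graph S \<and> card (pverts S) = card V \<and>
    graph_diam S = 2 * r + 1 \<and> lam \<le> steklov_lambda2 S"
proof -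
  let ?ls = "Suc r # r # ls"
  let ?P = "paths_at_root ?ls"
  have ls': "2 \<le> length ?ls" "\<forall>l\<in>set ?ls. 1 \<le> l"
    using r ls by auto
  obtain f where f: "bij_betw f (pverts ?P) V"
    using finite_same_card_bij[OF finite_paths V(1)] V(2) card_paths by metis
  define S where "S = \<lparr>pverts = f ` pverts ?P, parcs = map_prod f f ` parcs ?P\<rparr>"
  have giso: "giso f ?P S"
    using f by (auto simp: giso_def S_def bij_betw_def)
  note I = parcs_paths_sub giso
  have rooted: "rooted (pverts S) (parcs S) (f None)
      (\<lambda>y. f (ppar (the_inv_into (pverts ?P) f y))) (\<lambda>y. pdepth (the_inv_into (pverts ?P) f y))"
    using giso_rooted[OF I rooted_paths] .
  have "spider S"
    using spider_iff giso ls' by blast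
  moreover have "tree_graph S"
    using rooted by (rule rooted_tree_graph)
  moreover have card: "card (pverts S) = card V"
    using f by (simp add: S_def bij_betw_def)
  moreover have "graph_diam S = 2 * r + 1"
    using giso_diam[OF I] graph_diam_paths[OF r] ls by simp
  moreover have "lam \<le> steklov_lambda2 S"
  proof -
    have leaves_P: "Some (0, r) \<in> leaves ?P" "Some (1, r - 1) \<in> leaves ?P"
      unfolding leaves_paths[OF ls'] by (force intro: image_eqI[of _ _ 0] image_eqI[of _ _ 1])+
    have ab: "f (Some (0, r)) \<in> leaves S" "f (Some (1, r - 1)) \<in> leaves S"
      using leaves_P giso_leaves[OF I] by auto
    have "inj_on f (pverts ?P)"
      using giso by (simp add: giso_def)
    then have neq: "f (Some (0, r)) \<noteq> f (Some (1, r - 1))"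
      using leaves_P inj_onD[of f "pverts ?P" "Some (0, r)" "Some (1, r - 1)"] by (auto simp: leaves_eq)
    have "2 \<le> card (pverts S)"
      using card V by simp
    then have bg: "boundary_graph (pverts S) (leaves S) (parcs S)"
      using rooted_boundary_graph[OF rooted] ab by blast
    obtain h where h: "(\<Sum>v\<in>leaves S. h v) = 0" "(\<Sum>v\<in>leaves S. (h v)\<^sup>2) = 1"
      "energy (parcs S) h = steklov_lambda2 S"
      using steklov_lambda2_min(2)[OF bg ab neq] by blast
    have "lam * (\<Sum>v\<in>leaves ?P. (h (f v))\<^sup>2) \<le> energy (parcs ?P) (\<lambda>v. h (f v))"
    proof (rule steklov_bound_paths[OF ls' lam(1)])
      show "1 < lam * real (?ls ! 0)"
        using lam by simp
      show "lam * real (?ls ! i) < 1" if i: "0 < i" "i < length ?ls" for i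
      proof -
        have "?ls ! i \<in> set (r # ls)"
          using i nth_mem[of "i - 1" "r # ls"] by (cases i) auto
        then have "real (?ls ! i) \<le> real r"
          using ls by auto
        then have "lam * real (?ls ! i) \<le> lam * real r"
          using lam(1) by (intro mult_left_mono) auto
        then show ?thesis
          using lam(3) by simp
      qed
      show "(\<Sum>i<length ?ls. 1 / (1 - lam * real (?ls ! i))) = 0"
      proof -
        have "(\<Sum>i<length ?ls. 1 / (1 - lam * real (?ls ! i))) =
            (\<Sum>i<length ?ls. map (\<lambda>l. 1 / (1 - lam * real l)) ?ls ! i)"
          by (intro sum.cong refl, subst nth_map) simp_all
        then show ?thesis
          using crit by (simp only: sum_list_sum_nth atLeast0LessThan length_map)
      qed
      show "(\<Sum>v\<in>leaves ?P. h (f v)) = 0"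
        using h(1) giso_sum_leaves[OF I, of h] by simp
    qed
    then show ?thesis
      using h giso_sum_leaves[OF I, of "\<lambda>v. (h v)\<^sup>2"] giso_energy[OF I, of h] by simp
  qed
  ultimately show ?thesis
    by blast
qed

section \<open>The central edge of a tree\<close>

context rooted
begin

lemma anc_of_child: "x \<in> children w \<Longrightarrow> w \<in> anc x"
  by (auto simp: children_def)

lemma child_on_path:
  assumes "x \<in> V" "w \<in> anc x" "w \<noteq> x"
  obtains y where "y \<in> children w" "y \<in> anc x"
proof -
  have "d w \<noteq> d x"
    using assms anc_depth_inj[OF assms(1,2) anc_refl] by auto
  then have "Suc (d w) \<le> d x"
    using anc_depth[OF assms(1,2)] by simp
  then obtain y where y: "y \<in> anc x" "d y = Suc (d w)"
    using anc_level[OF assms(1)] by blast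
  have yV: "y \<in> V"
    using y anc_sub assms by blast
  moreover have "y \<noteq> c"
    using y d_c by auto
  moreover have "par y = w"
    using anc_depth_inj[OF assms(1), of "par y" w] anc_trans[OF par_anc y(1)] d_par' yV y assms
    by simp
  ultimately show ?thesis
    using that y by (simp add: children_def)
qed

lemma leaf_anc: "x \<in> V \<Longrightarrow> w \<in> anc x \<Longrightarrow> children w = {} \<Longrightarrow> x = w"
  by (metis child_on_path empty_iff)

lemma children_root: "children c = {a \<in> V. d a = 1}"
  using d_par d_eq_0_iff par_in_V d_c by (force simp: children_def)

text \<open>Without branching away from the root, depth determines a vertex within a branch: the
  parents agree by induction and have only one child.\<close>

lemma same_branch_eq:
  assumes ch: "\<And>w. w \<in> V \<Longrightarrow> w \<noteq> c \<Longrightarrow> card (children w) \<le> 1" and a: "a \<noteq> c"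
  shows "x \<in> V \<Longrightarrow> y \<in> V \<Longrightarrow> a \<in> anc x \<Longrightarrow> a \<in> anc y \<Longrightarrow> d x = d y \<Longrightarrow> x = y"
proof (induction "d x" arbitrary: x y rule: less_induct)
  case less
  have aV: "a \<in> V"
    using less anc_sub by blast
  have da: "d a > 0"
    using a aV d_eq_0_iff by auto
  show ?case
  proof (cases "a = x")
    case True
    then have "a = y"
      using anc_depth_inj[of y a y] less by simp
    then show ?thesis
      using True by simp
  next
    case False
    then have "a \<noteq> y"
      using anc_depth_inj[of x a x] less by auto
    then have a': "a \<in> anc (par x)" "a \<in> anc (par y)"
      using less False anc_par by blast+
    have xy: "x \<noteq> c" "y \<noteq> c"
      using less da d_c anc_depth[OF less(2,4)] by auto
    have dp: "d x = Suc (d (par x))" "d y = Suc (d (par y))"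
      using d_par less xy by auto
    have "par x = par y"
      using less.hyps[OF _ par_in_V par_in_V a'] dp less by simp
    moreover have "par x \<noteq> c"
      using a'(1) da d_c anc_depth[OF par_in_V[OF less(2)] a'(1)] by auto
    moreover have "x \<in> children (par x)" "y \<in> children (par y)"
      using less xy by (auto simp: children_def)
    ultimately show ?thesis
      using ch[OF par_in_V[OF less(2)]] finite_children card_le_Suc0_iff_eq[of "children (par x)"]
      by simp
  qed
qed

text \<open>A walk that leaves the branch of \<open>v\<close> must cross from \<open>v\<close> to
  the root, and each step changes the depth by at most 1.\<close>

lemma branch_walk:
  assumes "v \<in> children c"
  shows "x \<in> V \<Longrightarrow> y \<in> V \<Longrightarrow> v \<in> anc x \<Longrightarrow> v \<notin> anc y \<Longrightarrow> (x, y) \<in> E ^^ k \<Longrightarrow> d x + d y \<le> k"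
proof (induction k arbitrary: x)
  case 0
  then show ?case by auto
next
  case (Suc k)
  obtain z where z: "(x, z) \<in> E" "(z, y) \<in> E ^^ k"
    using Suc.prems(5) relpow_Suc_D2 by metis
  have zV: "z \<in> V"
    using z E_sub by auto
  have "d x \<le> Suc (d z)"
    using d_edge symD[OF sym_E z(1)] by blast
  show ?case
  proof (cases "v \<in> anc z")
    case True
    then show ?thesis
      using Suc.IH[OF zV Suc.prems(2) _ Suc.prems(4) z(2)] \<open>d x \<le> Suc (d z)\<close> by simp
  next
    case False
    have "z = par x"
      using z(1)
    proof (cases rule: edge_cases)
      case 2
      then show ?thesis
        using False Suc.prems(3) anc_trans[of v x z] par_anc[of z] by simp
    qed
    then have "x = v"
      using False Suc.prems(3) anc_par[of x] by auto
    then have "z = c" "d x = 1"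
      using assms \<open>z = par x\<close> children_root by (auto simp: children_def)
    then show ?thesis
      using d_walk[OF z(2)] d_c by simp
  qed
qed

end

text \<open>Each vertex other than \<open>c\<close> gets as coordinates its branch at
  \<open>c\<close> and its depth minus one. They are injective by \<open>same_branch_eq\<close>; the
  length of a leg is the largest depth in its branch.\<close>

lemma spiderI:
  assumes T: "tree_graph T" and c: "c \<in> pverts T" and deg_c: "2 \<le> card (nbrs (parcs T) c)"
    and deg: "\<And>w. w \<in> pverts T \<Longrightarrow> w \<noteq> c \<Longrightarrow> card (nbrs (parcs T) w) \<le> 2"
  shows "spider T"
proof -
  obtain par d where "rooted (pverts T) (parcs T) c par d"
    using tree_graph_rooted[OF T c] by blast
  then interpret rooted "pverts T" "parcs T" c par d .
  have ch: "card (children w) \<le> 1" if "w \<in> pverts T" "w \<noteq> c" for w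
    using deg[OF that] card_nbrs[OF that] by simp
  obtain xs where xs: "set xs = children c" "distinct xs"
    using finite_distinct_list[OF finite_children] by blast
  have xs_V: "xs ! i \<in> pverts T" "d (xs ! i) = 1" if "i < length xs" for i
    using nth_mem[OF that] xs(1) children_root by auto
  define m where "m a = Max (d ` {w \<in> pverts T. a \<in> anc w})" for a
  define ls where "ls = map m xs"
  have ex: "\<exists>!i. i < length xs \<and> xs ! i \<in> anc w" if w: "w \<in> pverts T" "w \<noteq> c" for w
  proof -
    have "d w \<noteq> 0"
      using w d_eq_0_iff by simp
    then have "1 \<le> d w"
      by simp
    then obtain a where a: "a \<in> anc w" "d a = 1"
      using anc_level[OF w(1)] by blast
    then have "a \<in> set xs"
      using anc_sub[OF w(1)] xs(1) children_root by auto
    then obtain i where i: "i < length xs" "xs ! i = a"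
      by (meson in_set_conv_nth)
    show ?thesis
    proof (rule ex1I[of _ i])
      show "i < length xs \<and> xs ! i \<in> anc w"
        using a i by simp
      fix j assume j: "j < length xs \<and> xs ! j \<in> anc w"
      then have "xs ! j = a"
        using anc_depth_inj[OF w(1), of "xs ! j" a] a xs_V by simp
      then show "j = i"
        using i j xs(2) nth_eq_iff_index_eq by metis
    qed
  qed
  define idx where "idx w = (THE i. i < length xs \<and> xs ! i \<in> anc w)" for w
  have idx: "idx w < length xs" "xs ! idx w \<in> anc w" if "w \<in> pverts T" "w \<noteq> c" for w
    using theI'[OF ex[OF that]] by (auto simp: idx_def)
  have idx_eq: "idx w = i" if "w \<in> pverts T" "w \<noteq> c" "i < length xs" "xs ! i \<in> anc w" for w i
    unfolding idx_def using the1_equality[OF ex[OF that(1,2)]] that(3,4) by blast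
  define g where "g w = (if w = c then None else Some (idx w, d w - 1))" for w
  have le_m: "d w \<le> m (xs ! i)" if "w \<in> pverts T" "xs ! i \<in> anc w" for w i
    unfolding m_def using that finV by (intro Max_ge) auto
  have m_attained: "\<exists>w\<in>pverts T. xs ! i \<in> anc w \<and> d w = m (xs ! i)" if "i < length xs" for i
  proof -
    have "m (xs ! i) \<in> d ` {w \<in> pverts T. xs ! i \<in> anc w}"
      unfolding m_def using finV xs_V[OF that] by (intro Max_in) auto
    then show ?thesis
      by auto
  qed
  have d_pos: "0 < d w" if "w \<in> pverts T" "w \<noteq> c" for w
    using that d_eq_0_iff[of w] by (intro gr0I) simp
  have "giso g T (paths_at_root ls)"
  proof (rule gisoI_rooted[OF _ _ cV E_eq, where par' = ppar])
    show "inj_on g (pverts T)"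
    proof (rule inj_onI)
      fix x y assume xy: "x \<in> pverts T" "y \<in> pverts T" "g x = g y"
      show "x = y"
      proof (cases "x = c \<or> y = c")
        case True
        then show ?thesis
          using xy(3) by (auto simp: g_def split: if_splits)
      next
        case False
        then have "idx x = idx y" "d x - 1 = d y - 1"
          using xy(3) by (auto simp: g_def)
        moreover have "xs ! idx x \<noteq> c"
          using xs_V(2)[OF idx(1)[of x]] xy False d_c by auto
        ultimately show ?thesis
          using same_branch_eq[OF ch, of "xs ! idx x" x y] idx(2)[of x] idx(2)[of y] xy False
            d_pos[of x] d_pos[of y] by simp
      qed
    qed
    show "pverts (paths_at_root ls) = g ` pverts T"
    proof
      show "g ` pverts T \<subseteq> pverts (paths_at_root ls)"
      proof
        fix y assume "y \<in> g ` pverts T"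
        then obtain w where w: "w \<in> pverts T" "y = g w"
          by blast
        show "y \<in> pverts (paths_at_root ls)"
        proof (cases "w = c")
          case True
          then show ?thesis using w None_in_paths by (simp add: g_def)
        next
          case False
          then have "d w - 1 < ls ! idx w"
            using le_m[OF w(1) idx(2)[OF w(1) False]] idx(1)[OF w(1) False] d_pos[OF w(1) False]
            by (simp add: ls_def)
          then show ?thesis
            using w False idx(1)[OF w(1) False] by (simp add: g_def pverts_paths ls_def)
        qed
      qed
      show "pverts (paths_at_root ls) \<subseteq> g ` pverts T"
      proof
        fix y assume y: "y \<in> pverts (paths_at_root ls)"
        show "y \<in> g ` pverts T"
        proof (cases y)
          case None
          then show ?thesis using cV by (auto simp: g_def image_iff)
        next
          case (Some p)
          then obtain i j where ij: "y = Some (i, j)" "i < length xs" "j < m (xs ! i)"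
            using y by (auto simp: pverts_paths ls_def)
          obtain x where x: "x \<in> pverts T" "xs ! i \<in> anc x" "d x = m (xs ! i)"
            using m_attained[OF ij(2)] by blast
          obtain w where w: "w \<in> anc x" "d w = Suc j"
            using anc_level[OF x(1), of "Suc j"] ij x by auto
          have wV: "w \<in> pverts T" and wc: "w \<noteq> c"
            using w anc_sub[OF x(1)] d_c by auto
          have "xs ! i \<in> anc w"
            using anc_linear[OF x(1,2) w(1)] xs_V[OF ij(2)] w(2) by simp
          then have "g w = y"
            using idx_eq[OF wV wc ij(2)] wc w(2) ij(1) by (simp add: g_def)
          then show ?thesis
            using wV by blast
        qed
      qed
    qed
    show "parcs (paths_at_root ls) = (\<lambda>w. (w, ppar w)) ` (pverts (paths_at_root ls) - {g c}) \<union>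
        (\<lambda>w. (ppar w, w)) ` (pverts (paths_at_root ls) - {g c})"
      using parcs_paths[of ls] by (simp add: g_def)
    fix w assume w: "w \<in> pverts T" "w \<noteq> c"
    show "g (par w) = ppar (g w)"
    proof (cases "par w = c")
      case True
      then show ?thesis
        using w d_par[OF w] d_c by (simp add: g_def)
    next
      case False
      have "xs ! idx (par w) \<in> anc w"
        using idx(2)[OF par_in_V[OF w(1)] False] par_anc anc_trans by blast
      then have "idx w = idx (par w)"
        using idx_eq[OF w idx(1)[OF par_in_V[OF w(1)] False]] by simp
      moreover have "d w - 1 = Suc (d (par w) - 1)"
        using d_par[OF w] d_pos[OF par_in_V[OF w(1)] False] by simp
      ultimately show ?thesis
        using w False by (simp add: g_def)
    qed
  qed
  then have "giso (the_inv_into (pverts T) g) (paths_at_root ls) T"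
    by (rule giso_sym[OF E_sub])
  moreover have "2 \<le> length ls"
    using deg_c card_nbrs_root xs distinct_card[OF xs(2)] by (simp add: ls_def)
  moreover have "\<forall>l\<in>set ls. 1 \<le> l"
  proof
    fix l assume "l \<in> set ls"
    then obtain i where "i < length xs" "l = m (xs ! i)"
      by (auto simp: ls_def in_set_conv_nth)
    then show "1 \<le> l"
      using le_m[of "xs ! i" i] xs_V[of i] by simp
  qed
  ultimately show ?thesis
    using spider_iff by blast
qed

text \<open>On a shortest walk between diametral vertices \<open>p\<close> and \<open>q\<close>, the
  edge \<open>uv\<close> comes after \<open>r\<close> steps. By \<open>branch_walk\<close>, a vertex
  outside the branch of \<open>v\<close> has distance at least \<open>Suc r + d w\<close> from
  \<open>q\<close>, and one inside at least \<open>d w + r\<close> from \<open>p\<close>; the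
  diameter then bounds the depths.\<close>

lemma ex_central_edge:
  assumes T: "tree_graph T" and diam: "graph_diam T = 2 * r + 1"
  obtains u par d v p q where "rooted (pverts T) (parcs T) u par d"
    "v \<in> rooted.children (pverts T) u par u"
    "p \<in> pverts T" "v \<notin> rooted.anc par p" "d p = r"
    "q \<in> pverts T" "v \<in> rooted.anc par q" "d q = Suc r"
    "\<And>w. w \<in> pverts T \<Longrightarrow> v \<notin> rooted.anc par w \<Longrightarrow> d w \<le> r"
    "\<And>w. w \<in> pverts T \<Longrightarrow> v \<in> rooted.anc par w \<Longrightarrow> d w \<le> Suc r"
proof -
  let ?V = "pverts T" and ?E = "parcs T"
  have G: "pair_graph T"
    using T by (simp add: tree_graph_def)
  then have fin: "finite ?V" and sub: "?E \<subseteq> ?V \<times> ?V" and sym: "sym ?E"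
    by (simp_all add: pair_graph_iff)
  have conn: "(x, y) \<in> ?E\<^sup>*" if "x \<in> ?V" "y \<in> ?V" for x y
    using T that by (auto simp: tree_graph_def connected_with_proj_iff[OF G])
  have ne: "?V \<noteq> {}"
    using T by (auto simp: tree_graph_def connected_with_proj_iff[OF G])
  have dist_walk: "(x, y) \<in> ?E ^^ graph_dist T x y" if "x \<in> ?V" "y \<in> ?V" for x y
    unfolding graph_dist_eq[OF sub that(1)]
    using rtrancl_imp_relpow[OF conn[OF that]] by (auto intro: LeastI)
  have walk: "\<exists>k\<le>2 * r + 1. (x, y) \<in> ?E ^^ k" if "x \<in> ?V" "y \<in> ?V" for x y
    using dist_walk[OF that] graph_dist_le_diam[OF fin that] diam by auto
  obtain p q where p: "p \<in> ?V" and q: "q \<in> ?V" and pq: "graph_dist T p q = 2 * r + 1"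
    using graph_diam_attained[OF fin ne] diam by metis
  have min: "2 * r + 1 \<le> k" if "(p, q) \<in> ?E ^^ k" for k
    using graph_dist_le[OF sub p that] pq by simp
  have "(p, q) \<in> ?E ^^ (r + Suc r)"
    using dist_walk[OF p q] pq by (simp add: mult_2)
  then obtain u where pu: "(p, u) \<in> ?E ^^ r" and uq: "(u, q) \<in> ?E ^^ Suc r"
    by (auto simp only: relpow_add relcomp_unfold)
  then obtain v where uv: "(u, v) \<in> ?E" and vq: "(v, q) \<in> ?E ^^ r"
    using relpow_Suc_D2 by metis
  have u: "u \<in> ?V" and v: "v \<in> ?V"
    using uv sub by auto
  obtain par d where R: "rooted ?V ?E u par d"
    using tree_graph_rooted[OF T u] by blast
  interpret rooted ?V ?E u par d by fact
  have "d p \<le> r" "d q \<le> Suc r"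
    using d_walk[OF relpow_sym[OF sym pu]] d_walk[OF uq] d_c by simp_all
  moreover have "2 * r + 1 \<le> d p + d q"
    using min walk_via_root[OF p q] by blast
  ultimately have dp: "d p = r" and dq: "d q = Suc r"
    by simp_all
  have vu: "v \<in> children u"
    using uv
  proof (cases rule: edge_cases)
    case 2
    then show ?thesis unfolding children_def by blast
  qed simp
  then have dv: "d v = 1"
    using children_root by simp
  \<comment> \<open>Otherwise the walk of length \<open>r\<close> from \<open>v\<close> to
    \<open>q\<close> would have to pass the root, which takes at least \<open>r + 2\<close>
    steps.\<close>
  have qv: "v \<in> anc q"
  proof (rule ccontr)
    assume "v \<notin> anc q"
    from branch_walk[OF vu v q _ this vq] show False
      using dq by simp
  qed
  \<comment> \<open>Otherwise \<open>p\<close> reaches \<open>v\<close> in \<open>r - 1\<close>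
    steps and \<open>q\<close> in \<open>r\<close> more, which is shorter than the distance.\<close>
  have pv: "v \<notin> anc p"
  proof
    assume "v \<in> anc p"
    from walk_anc[OF p this] have "(p, q) \<in> ?E ^^ (r - 1 + r)"
      using vq by (auto simp: relpow_add dp dv)
    moreover have "1 \<le> r"
      using anc_depth[OF p \<open>v \<in> anc p\<close>] dv dp by simp
    ultimately show False
      using min by fastforce
  qed
  show thesis
  proof (rule that[OF R vu p pv dp q qv dq])
    fix w assume w: "w \<in> ?V"
    show "d w \<le> r" if wv: "v \<notin> anc w"
    proof -
      obtain k where "k \<le> 2 * r + 1" "(q, w) \<in> ?E ^^ k"
        using walk[OF q w] by blast
      then show ?thesis
        using branch_walk[OF vu q w qv wv] dq by fastforce
    qed
    show "d w \<le> Suc r" if wv: "v \<in> anc w"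
    proof -
      obtain k where "k \<le> 2 * r + 1" "(w, p) \<in> ?E ^^ k"
        using walk[OF w p] by blast
      then show ?thesis
        using branch_walk[OF vu w p wv pv] dp by fastforce
    qed
  qed
qed

section \<open>Legs of a tree and the test function\<close>

text \<open>The root is one end of the central edge, so depths in the branch of \<open>v\<close>
  exceed by 1 those counted from \<open>v\<close>; from their own end, \<open>p\<close> and
  \<open>q\<close> both have distance \<open>r\<close>.\<close>

locale centred = rooted V E c par d
  for V :: "'a set" and E c par d +
  fixes v p q :: 'a and r :: nat
  assumes r: "1 \<le> r" and v_child: "v \<in> children c"
    and p: "p \<in> V" "v \<notin> anc p" "d p = r"
    and q: "q \<in> V" "v \<in> anc q" "d q = Suc r"
    and depth_le: "\<And>w. w \<in> V \<Longrightarrow> v \<notin> anc w \<Longrightarrow> d w \<le> r"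
      "\<And>w. w \<in> V \<Longrightarrow> v \<in> anc w \<Longrightarrow> d w \<le> Suc r"
begin

definition W :: "'a set" where "W = V - {c, v}"

definition L :: "'a set" where "L = {w \<in> V. card (nbrs E w) = 1}"

definition B :: "'a set" where "B = {w \<in> V. v \<in> anc w}"

text \<open>Every vertex chooses a leaf below it; the paths to the two deepest leaves \<open>p\<close> and \<open>q\<close> have
  priority. The vertices that choose a leaf \<open>w\<close> become its leg, of length \<open>leg w\<close>.\<close>

definition choice :: "'a \<Rightarrow> 'a" where
  "choice a = (if a \<in> anc p then p else if a \<in> anc q then q
     else SOME w. w \<in> V \<and> children w = {} \<and> a \<in> anc w)"

definition fibre :: "'a \<Rightarrow> 'a set" where "fibre w = {a \<in> W. choice a = w}"

definition leg :: "'a \<Rightarrow> nat" where "leg w = card (fibre w)"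

lemma v_V: "v \<in> V" and v_neq: "v \<noteq> c" and par_v: "par v = c" and d_v: "d v = 1"
  using v_child children_root by (auto simp: children_def)

lemma nbrs_c_ge: "2 \<le> card (nbrs E c)"
proof -
  obtain a where a: "a \<in> anc p" "d a = 1"
    using anc_level[OF p(1), of 1] p(3) r by auto
  then have "a \<in> children c" "a \<noteq> v"
    using anc_sub[OF p(1)] children_root p(2) by auto
  then have "card {a, v} \<le> card (children c)"
    using v_child finite_children by (intro card_mono) auto
  then show ?thesis
    using \<open>a \<noteq> v\<close> card_nbrs_root by simp
qed

lemma children_v: "children v \<noteq> {}"
proof -
  have "v \<noteq> q"
    using q(3) d_v r by auto
  then show ?thesis
    using child_on_path[OF q(1,2)] by blast
qed

lemma L_iff: "w \<in> L \<longleftrightarrow> w \<in> V \<and> children w = {}"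
proof (cases "w = c")
  case True
  then show ?thesis
    using nbrs_c_ge v_child by (auto simp: L_def)
next
  case False
  then show ?thesis
    using leaf_iff by (auto simp: L_def)
qed

lemma L_sub_W: "L \<subseteq> W"
  using v_child children_v by (auto simp: L_iff W_def)

lemma finite_W: "finite W" and finite_L: "finite L"
  using finV by (simp_all add: W_def L_def)

lemma p_L: "p \<in> L"
proof -
  have "x \<notin> children p" for x
  proof
    assume x: "x \<in> children p"
    then have xV: "x \<in> V" "par x = p" "x \<noteq> c"
      by (auto simp: children_def)
    then have dx: "d x = Suc r"
      using d_par[of x] p(3) by simp
    moreover have "v \<noteq> x"
      using dx d_v r by auto
    then have "v \<notin> anc x"
      using anc_par[of x] xV p(2) by auto
    ultimately show False
      using depth_le(1)[OF xV(1)] by simp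
  qed
  then show ?thesis
    using p(1) by (auto simp: L_iff)
qed

lemma q_L: "q \<in> L"
proof -
  have "x \<notin> children q" for x
  proof
    assume x: "x \<in> children q"
    then have xV: "x \<in> V" "par x = q" "x \<noteq> c"
      by (auto simp: children_def)
    then have "d x = Suc (Suc r)"
      using d_par[of x] q(3) by simp
    moreover have "v \<in> anc x"
      using anc_par[of x] xV q(2) by auto
    ultimately show False
      using depth_le(2)[OF xV(1)] by simp
  qed
  then show ?thesis
    using q(1) by (auto simp: L_iff)
qed

lemma p_B: "p \<notin> B" and q_B: "q \<in> B"
  using p q by (auto simp: B_def)

lemma choice:
  assumes "a \<in> V"
  shows "choice a \<in> L" "a \<in> anc (choice a)"
proof -
  have "\<exists>w. w \<in> V \<and> children w = {} \<and> a \<in> anc w"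
    using ex_leaf_below[OF assms] by blast
  note S = someI_ex[OF this]
  show "choice a \<in> L"
    using S p_L q_L by (auto simp: choice_def L_iff)
  show "a \<in> anc (choice a)"
    using S by (simp add: choice_def)
qed

lemma choice_leaf: "w \<in> L \<Longrightarrow> choice w = w"
  using choice[of w] leaf_anc[of "choice w" w] by (simp add: L_iff)

text \<open>The \<open>SOME\<close> in \<open>choice\<close> is taken at each vertex independently,
  so a fibre may have gaps. The lower bounds for leaf values need only its cardinality and this
  inclusion.\<close>

lemma fibre_sub: "fibre w \<subseteq> anc w - {c, v}"
  using choice by (auto simp: fibre_def W_def)

text \<open>Below \<open>v\<close> the depth may be \<open>Suc r\<close>, but there \<open>v\<close>
  is removed as well, so both sides give the same bound.\<close>

lemma card_proper_anc_le: "w \<in> V \<Longrightarrow> card (anc w - {c, v}) \<le> r"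
proof (cases "v \<in> anc w")
  case True
  assume w: "w \<in> V"
  have "card (anc w - {c, v}) = card (anc w) - card {c, v}"
    using True root_anc[OF w] by (intro card_Diff_subset) auto
  then show ?thesis
    using card_anc[OF w] depth_le(2)[OF w True] v_neq by simp
next
  case False
  assume w: "w \<in> V"
  have "anc w - {c, v} = anc w - {c}"
    using False by auto
  moreover have "card (anc w - {c}) = card (anc w) - card {c}"
    using root_anc[OF w] by (intro card_Diff_subset) auto
  ultimately show ?thesis
    using card_anc[OF w] depth_le(1)[OF w False] by simp
qed

lemma leg_le: "w \<in> V \<Longrightarrow> leg w \<le> r"
  unfolding leg_def
  using card_mono[OF _ fibre_sub[of w]] finite_anc[of w] card_proper_anc_le[of w] by fastforce

lemma leg_ge: "w \<in> L \<Longrightarrow> 1 \<le> leg w"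
proof -
  assume w: "w \<in> L"
  have "w \<in> fibre w"
    using w L_sub_W choice_leaf by (auto simp: fibre_def)
  moreover have "finite (fibre w)"
    using finite_W by (simp add: fibre_def)
  ultimately show ?thesis
    unfolding leg_def by (metis One_nat_def Suc_leI card_gt_0_iff empty_iff)
qed

lemma leg_p: "leg p = r"
proof -
  have "fibre p = anc p - {c}"
  proof
    show "anc p - {c} \<subseteq> fibre p"
      using p anc_sub[OF p(1)] by (auto simp: fibre_def W_def choice_def)
  qed (use fibre_sub in auto)
  moreover have "card (anc p - {c}) = card (anc p) - card {c}"
    using root_anc[OF p(1)] by (intro card_Diff_subset) auto
  ultimately show ?thesis
    using card_anc[OF p(1)] p(3) by (simp add: leg_def)
qed

lemma leg_q: "leg q = r"
proof -
  have "fibre q = anc q - {c, v}"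
  proof
    show "anc q - {c, v} \<subseteq> fibre q"
    proof
      fix a assume a: "a \<in> anc q - {c, v}"
      then have aV: "a \<in> V"
        using anc_sub[OF q(1)] by blast
      then have "d v \<le> d a"
        using a d_eq_0_iff[of a] d_v by (cases "d a") auto
      then have "v \<in> anc a"
        using anc_linear[OF q(1,2)] a by blast
      then have "a \<notin> anc p"
        using anc_trans p(2) by blast
      then show "a \<in> fibre q"
        using a aV by (simp add: fibre_def W_def choice_def)
    qed
  qed (use fibre_sub in auto)
  moreover have "card (anc q - {c, v}) = card (anc q) - card {c, v}"
    using root_anc[OF q(1)] q(2) by (intro card_Diff_subset) auto
  ultimately show ?thesis
    using card_anc[OF q(1)] q(3) v_neq by (simp add: leg_def)
qed

text \<open>Hence each leg stays on one side of the central edge, and the test function has one sign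
  on it.\<close>

lemma choice_B: "a \<in> W \<Longrightarrow> choice a \<in> B \<longleftrightarrow> a \<in> B"
proof
  assume a: "a \<in> W"
  then have aV: "a \<in> V" "a \<noteq> c" "a \<noteq> v"
    by (auto simp: W_def)
  note ch = choice[OF aV(1)]
  show "a \<in> B \<Longrightarrow> choice a \<in> B"
    using ch anc_trans by (auto simp: B_def L_def)
  assume "choice a \<in> B"
  then have B: "choice a \<in> V" "v \<in> anc (choice a)"
    by (auto simp: B_def)
  have "d v \<le> d a"
    using aV d_eq_0_iff[of a] d_v by (cases "d a") auto
  from anc_linear[OF B ch(2) this] show "a \<in> B"
    using aV(1) by (simp add: B_def)
qed

lemma sum_over_choice: "(\<Sum>a\<in>W. f (choice a)) = (\<Sum>w\<in>L. real (leg w) * f w)"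
proof -
  have "(\<Sum>w\<in>L. \<Sum>a\<in>{a \<in> W. choice a = w}. f (choice a)) = (\<Sum>a\<in>W. f (choice a))"
    using finite_W finite_L choice(1) by (intro sum.group) (auto simp: W_def)
  then have "(\<Sum>a\<in>W. f (choice a)) = (\<Sum>w\<in>L. \<Sum>a\<in>fibre w. f (choice a))"
    by (simp add: fibre_def)
  also have "\<dots> = (\<Sum>w\<in>L. \<Sum>a\<in>fibre w. f w)"
    by (intro sum.cong refl) (auto simp: fibre_def)
  finally show ?thesis
    by (simp add: leg_def)
qed

text \<open>The two vertices on no leg account for the centre of the spider and for the extra vertex
  of its prolonged leg.\<close>

lemma sum_leg: "(\<Sum>w\<in>L. leg w) = card V - 2"
proof -
  have "real (\<Sum>w\<in>L. leg w) = real (card W)"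
    using sum_over_choice[of "\<lambda>_. 1"] by simp
  then have "(\<Sum>w\<in>L. leg w) = card W"
    by linarith
  also have "\<dots> = card V - 2"
    unfolding W_def using cV v_V v_neq by (subst card_Diff_subset) auto
  finally show ?thesis .
qed

section \<open>The test function and its quotient\<close>

context
  fixes lam :: real
  assumes lam: "0 < lam" "lam * r < 1"
begin

text \<open>Solution \<open>s\<close> of \<open>s = lam * (1 + leg w * s)\<close>, the Steklov
  condition at the end of a leg that starts with value 1.\<close>

definition slope :: "'a \<Rightarrow> real" where "slope w = lam / (1 - lam * leg w)"

text \<open>The value is 1 at both ends of the central edge. Further away, each edge contributes the
  slope of the leg of its lower end, including legs that belong to other leaves.\<close>

definition height :: "'a \<Rightarrow> real" where
  "height w = 1 + (\<Sum>a\<in>anc w - {c, v}. slope (choice a))"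

definition test :: "real \<Rightarrow> real \<Rightarrow> 'a \<Rightarrow> real" where
  "test \<alpha> \<beta> w = (if w \<in> B then - \<beta> * height w else \<alpha> * height w)"

lemma lam_leg: "w \<in> V \<Longrightarrow> lam * leg w < 1"
proof -
  assume "w \<in> V"
  then have "lam * leg w \<le> lam * r"
    using lam leg_le by (intro mult_left_mono) auto
  then show ?thesis
    using lam(2) by linarith
qed

lemma slope_pos: "w \<in> V \<Longrightarrow> 0 < slope w"
  using lam lam_leg by (simp add: slope_def)

lemma slope_choice_pos: "a \<in> V \<Longrightarrow> 0 < slope (choice a)"
  using choice(1) slope_pos by (simp add: L_def)

lemma height_root: "height c = 1" "height v = 1"
proof -
  have "anc c = {c}"
    using leaf_anc root_anc card_anc[OF cV] d_c anc_refl[of c] card_1_singletonE by (metis One_nat_def singletonD)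
  then show "height c = 1"
    by (simp add: height_def)
  have "anc v = {v, c}"
    using anc_par[of v] par_v \<open>anc c = {c}\<close> by simp
  then show "height v = 1"
    by (simp add: height_def)
qed

lemma height_step: "w \<in> W \<Longrightarrow> height w = height (par w) + slope (choice w)"
proof -
  assume w: "w \<in> W"
  then have wV: "w \<in> V" "w \<noteq> c"
    by (auto simp: W_def)
  have "w \<notin> anc (par w)"
    using anc_depth[OF par_in_V[OF wV(1)], of w] d_par[OF wV] by auto
  moreover have "anc w - {c, v} = insert w (anc (par w) - {c, v})"
    using w anc_par[of w] by (auto simp: W_def)
  ultimately show ?thesis
    using finite_anc[OF par_in_V[OF wV(1)]] by (simp add: height_def)
qed

lemma leaf_scale: "w \<in> L \<Longrightarrow> 1 + leg w * slope w = 1 / (1 - lam * leg w)"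
  using lam_leg[of w] by (simp add: L_def slope_def field_simps)

text \<open>The vertices of the leg of \<open>w\<close> alone produce the value
  \<open>1 / (1 - lam * leg w)\<close> known from the spider; any other vertex on the way adds a
  positive slope.\<close>

lemma leaf_height:
  assumes w: "w \<in> L"
  shows "1 / (1 - lam * leg w) \<le> height w"
    and "a \<in> anc w - {c, v} \<Longrightarrow> choice a \<noteq> w \<Longrightarrow> 1 / (1 - lam * leg w) < height w"
proof -
  have wV: "w \<in> V"
    using w by (simp add: L_def)
  have fin: "finite (anc w - {c, v})"
    using finite_anc[OF wV] by simp
  have pos: "0 < slope (choice a)" if "a \<in> anc w - {c, v}" for a
    using that anc_sub[OF wV] slope_choice_pos by blast
  have "leg w * slope w = (\<Sum>a\<in>fibre w. slope (choice a))"
    by (simp add: leg_def fibre_def)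
  then have eq: "1 / (1 - lam * leg w) = 1 + (\<Sum>a\<in>fibre w. slope (choice a))"
    using leaf_scale[OF w] by simp
  show "1 / (1 - lam * leg w) \<le> height w"
    unfolding eq height_def using fin fibre_sub pos
    by (intro add_left_mono sum_mono2) (auto intro: less_imp_le)
  show "1 / (1 - lam * leg w) < height w" if a: "a \<in> anc w - {c, v}" "choice a \<noteq> w"
    unfolding eq height_def using fin fibre_sub pos a
    by (intro add_strict_left_mono sum_strict_mono2[of _ _ a]) (auto simp: fibre_def intro: less_imp_le)
qed

text \<open>The central edge joins the values \<alpha> and -\<beta>, since \<open>height\<close> is
  1 at both its ends. Every other edge is charged to the leg of its lower end.\<close>

lemma energy_test:
  "energy E (test \<alpha> \<beta>) =
     (\<alpha> + \<beta>)\<^sup>2 + (\<Sum>w\<in>L. (if w \<in> B then \<beta> else \<alpha>)\<^sup>2 * (leg w * (slope w)\<^sup>2))"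
proof -
  define co where "co w = (if w \<in> B then \<beta> else \<alpha>)" for w
  have V: "V - {c} = insert v W" "v \<notin> W"
    using v_V v_neq by (auto simp: W_def)
  have "v \<in> B" "c \<notin> B"
    using v_V anc_depth[OF cV, of v] d_v d_c by (auto simp: B_def)
  then have v: "(test \<alpha> \<beta> v - test \<alpha> \<beta> (par v))\<^sup>2 = (\<alpha> + \<beta>)\<^sup>2"
    by (simp add: test_def par_v height_root power2_eq_square algebra_simps)
  have w: "(test \<alpha> \<beta> w - test \<alpha> \<beta> (par w))\<^sup>2 = (co (choice w))\<^sup>2 * (slope (choice w))\<^sup>2"
    if w: "w \<in> W" for w
  proof -
    have wV: "w \<in> V" "w \<noteq> c" "w \<noteq> v"
      using w by (auto simp: W_def)
    have "par w \<in> B \<longleftrightarrow> w \<in> B"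
      using anc_par[of w] wV par_in_V[OF wV(1)] by (auto simp: B_def)
    then show ?thesis
      using height_step[OF w] choice_B[OF w]
      by (auto simp: test_def co_def power2_eq_square algebra_simps)
  qed
  have "energy E (test \<alpha> \<beta>) = (\<alpha> + \<beta>)\<^sup>2 + (\<Sum>w\<in>W. (co (choice w))\<^sup>2 * (slope (choice w))\<^sup>2)"
    unfolding energy_rooted V(1) using finite_W V(2) v w by simp
  also have "(\<Sum>w\<in>W. (co (choice w))\<^sup>2 * (slope (choice w))\<^sup>2) =
      (\<Sum>w\<in>L. leg w * ((co w)\<^sup>2 * (slope w)\<^sup>2))"
    by (rule sum_over_choice)
  finally show ?thesis
    by (simp add: co_def mult.left_commute)
qed

lemma energy_minus_boundary:
  assumes "\<alpha> > 0" "\<beta> > 0"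
  shows "energy E (test \<alpha> \<beta>) - lam * (\<Sum>w\<in>L. (test \<alpha> \<beta> w)\<^sup>2) \<le>
      (\<alpha> + \<beta>)\<^sup>2 - (\<alpha>\<^sup>2 * (\<Sum>w\<in>L - B. slope w) + \<beta>\<^sup>2 * (\<Sum>w\<in>L \<inter> B. slope w))" (is "?l \<le> ?r")
    and "\<exists>w\<in>L. \<exists>a\<in>anc w - {c, v}. choice a \<noteq> w \<Longrightarrow>
      energy E (test \<alpha> \<beta>) - lam * (\<Sum>w\<in>L. (test \<alpha> \<beta> w)\<^sup>2) <
      (\<alpha> + \<beta>)\<^sup>2 - (\<alpha>\<^sup>2 * (\<Sum>w\<in>L - B. slope w) + \<beta>\<^sup>2 * (\<Sum>w\<in>L \<inter> B. slope w))"
proof -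
  define co where "co w = (if w \<in> B then \<beta> else \<alpha>)" for w
  have co: "co w > 0" for w
    using assms by (simp add: co_def)
  have sq: "(test \<alpha> \<beta> w)\<^sup>2 = (co w)\<^sup>2 * (height w)\<^sup>2" for w
    by (simp add: test_def co_def power_mult_distrib)
  \<comment> \<open>Surplus of the boundary term at \<open>w\<close> over the spider; it is positive
    once the path to \<open>w\<close> meets the leg of another leaf.\<close>
  define D where "D w = (co w)\<^sup>2 * (lam * ((height w)\<^sup>2 - (1 / (1 - lam * leg w))\<^sup>2))" for w
  \<comment> \<open>This is why only the sums of slopes on the two sides survive.\<close>
  have key: "leg w * (slope w)\<^sup>2 - lam * (1 / (1 - lam * leg w))\<^sup>2 = - slope w" if "w \<in> L" for w
  proof -
    have "1 - lam * leg w \<noteq> 0"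
      using lam_leg[of w] that by (simp add: L_def)
    then show ?thesis
      by (simp add: slope_def divide_simps power2_eq_square) algebra
  qed
  have "?l = (\<alpha> + \<beta>)\<^sup>2 + (\<Sum>w\<in>L. (co w)\<^sup>2 * (leg w * (slope w)\<^sup>2) - lam * ((co w)\<^sup>2 * (height w)\<^sup>2))"
    by (simp add: energy_test sq co_def sum_subtractf sum_distrib_left)
  also have "(\<Sum>w\<in>L. (co w)\<^sup>2 * (leg w * (slope w)\<^sup>2) - lam * ((co w)\<^sup>2 * (height w)\<^sup>2)) =
      (\<Sum>w\<in>L. (co w)\<^sup>2 * (- slope w) - D w)"
    by (intro sum.cong refl) (simp add: key[symmetric] D_def algebra_simps)
  also have "\<dots> = - (\<Sum>w\<in>L. (co w)\<^sup>2 * slope w) - (\<Sum>w\<in>L. D w)"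
    by (simp add: sum_subtractf sum_negf)
  also have "(\<Sum>w\<in>L. (co w)\<^sup>2 * slope w) =
      \<alpha>\<^sup>2 * (\<Sum>w\<in>L - B. slope w) + \<beta>\<^sup>2 * (\<Sum>w\<in>L \<inter> B. slope w)"
  proof -
    have "(\<Sum>w\<in>L. (co w)\<^sup>2 * slope w) =
        (\<Sum>w\<in>L \<inter> B. (co w)\<^sup>2 * slope w) + (\<Sum>w\<in>L - B. (co w)\<^sup>2 * slope w)"
      by (rule sum.Int_Diff[OF finite_L])
    moreover have "(\<Sum>w\<in>L \<inter> B. (co w)\<^sup>2 * slope w) = \<beta>\<^sup>2 * (\<Sum>w\<in>L \<inter> B. slope w)"
      unfolding sum_distrib_left by (intro sum.cong) (auto simp: co_def)
    moreover have "(\<Sum>w\<in>L - B. (co w)\<^sup>2 * slope w) = \<alpha>\<^sup>2 * (\<Sum>w\<in>L - B. slope w)"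
      unfolding sum_distrib_left by (intro sum.cong) (auto simp: co_def)
    ultimately show ?thesis
      by simp
  qed
  finally have eq: "?l = ?r - (\<Sum>w\<in>L. D w)"
    by simp
  have scale_pos: "0 \<le> 1 / (1 - lam * leg w)" if "w \<in> L" for w
    using lam_leg[of w] that by (simp add: L_def)
  have D_nonneg: "0 \<le> D w" if "w \<in> L" for w
    using power_mono[OF leaf_height(1)[OF that] scale_pos[OF that], of 2] lam(1)
    by (simp add: D_def)
  then show "?l \<le> ?r"
    using sum_nonneg[of L D] eq by simp
  assume "\<exists>w\<in>L. \<exists>a\<in>anc w - {c, v}. choice a \<noteq> w"
  then obtain w a where w: "w \<in> L" and a: "a \<in> anc w - {c, v}" "choice a \<noteq> w"
    by blast
  have "0 < D w"
    using power_strict_mono[OF leaf_height(2)[OF w a] scale_pos[OF w], of 2] lam(1) co[of w]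
    by (simp add: D_def)
  then have "0 < (\<Sum>w\<in>L. D w)"
    using finite_L w D_nonneg by (intro sum_pos2[of _ w]) auto
  then show "?l < ?r"
    using eq by simp
qed

text \<open>Zero mean fixes the ratio of \<alpha> and \<beta>, so the bound must hold whatever this
  ratio is. It does by Cauchy-Schwarz, here as the identity with the square
  \<open>(F * \<alpha> - G * \<beta>)^2\<close>, combined with
  \<open>F + G \<le> F * G\<close>.\<close>

lemma ex_test:
  fixes F G :: real
  assumes F: "F = (\<Sum>w\<in>L - B. slope w)" and G: "G = (\<Sum>w\<in>L \<inter> B. slope w)"
    and FG: "F + G \<le> F * G"
    and strict: "F + G < F * G \<or> (\<exists>w\<in>L. \<exists>a\<in>anc w - {c, v}. choice a \<noteq> w)"
  shows "\<exists>h. (\<Sum>w\<in>L. h w) = 0 \<and> 0 < (\<Sum>w\<in>L. (h w)\<^sup>2) \<and> energy E h < lam * (\<Sum>w\<in>L. (h w)\<^sup>2)"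
proof -
  have hpos: "0 < height w" if "w \<in> L" for w
  proof -
    have "0 < 1 / (1 - lam * leg w)"
      using lam_leg[of w] that by (simp add: L_def)
    then show ?thesis
      using leaf_height(1)[OF that] by linarith
  qed
  have fin: "finite (L - B)" "finite (L \<inter> B)"
    using finite_L by auto
  have pq: "p \<in> L - B" "q \<in> L \<inter> B"
    using p_L q_L p_B q_B by auto
  \<comment> \<open>Each side is weighted by the total height of the other one, so the boundary
    values cancel.\<close>
  define \<alpha> \<beta> where "\<alpha> = (\<Sum>w\<in>L \<inter> B. height w)" and "\<beta> = (\<Sum>w\<in>L - B. height w)"
  have pos: "\<alpha> > 0" "\<beta> > 0"
    unfolding \<alpha>_def \<beta>_def using fin pq hpos
    by (auto intro!: sum_pos)
  have FGpos: "F > 0" "G > 0"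
    unfolding F G using fin pq slope_pos by (auto intro!: sum_pos simp: L_def)
  let ?h = "test \<alpha> \<beta>"
  have "(\<Sum>w\<in>L. ?h w) = (\<Sum>w\<in>L \<inter> B. ?h w) + (\<Sum>w\<in>L - B. ?h w)"
    by (rule sum.Int_Diff[OF finite_L])
  also have "(\<Sum>w\<in>L \<inter> B. ?h w) = - \<beta> * \<alpha>"
    unfolding \<alpha>_def sum_distrib_left by (intro sum.cong) (auto simp: test_def)
  also have "(\<Sum>w\<in>L - B. ?h w) = \<alpha> * \<beta>"
    unfolding \<beta>_def sum_distrib_left by (intro sum.cong) (auto simp: test_def)
  finally have zero: "(\<Sum>w\<in>L. ?h w) = 0"
    by simp
  have "0 < (?h p)\<^sup>2"
    using pos hpos[OF p_L] p_B by (simp add: test_def)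
  then have sq: "0 < (\<Sum>w\<in>L. (?h w)\<^sup>2)"
    using finite_L p_L by (intro sum_pos2[of _ p]) auto
  define M where "M = \<alpha>\<^sup>2 * F + \<beta>\<^sup>2 * G"
  have M: "M > 0"
    using pos FGpos by (simp add: M_def add_pos_pos)
  have cs: "(\<alpha> + \<beta>)\<^sup>2 * (F * G) \<le> M * (F + G)"
  proof -
    have "M * (F + G) - (\<alpha> + \<beta>)\<^sup>2 * (F * G) = (F * \<alpha> - G * \<beta>)\<^sup>2"
      by (simp add: M_def power2_eq_square algebra_simps)
    then show ?thesis
      by (metis diff_ge_0_iff_ge zero_le_power2)
  qed
  have FG0: "0 < F * G"
    using FGpos by simp
  have "M * (F + G) \<le> M * (F * G)"
    using FG M by (intro mult_left_mono) auto
  then have le: "(\<alpha> + \<beta>)\<^sup>2 \<le> M"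
    using cs FG0 by (meson mult_le_cancel_right_pos order_trans)
  have "energy E ?h - lam * (\<Sum>w\<in>L. (?h w)\<^sup>2) < 0"
    using strict
  proof
    assume "F + G < F * G"
    then have "M * (F + G) < M * (F * G)"
      using M by simp
    then have "(\<alpha> + \<beta>)\<^sup>2 < M"
      using cs FG0 by (meson mult_less_cancel_right_pos order_le_less_trans)
    then show ?thesis
      using energy_minus_boundary(1)[OF pos] by (simp add: M_def F G)
  next
    assume "\<exists>w\<in>L. \<exists>a\<in>anc w - {c, v}. choice a \<noteq> w"
    from energy_minus_boundary(2)[OF pos this] le show ?thesis
      by (simp add: M_def F G)
  qed
  then show ?thesis
    using zero sq by (intro exI[of _ ?h]) simp
qed

end

end

section \<open>Comparison with a spider\<close>

context centred
begin

lemma sibling_eq: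
  assumes "x \<in> children w" "y \<in> children w" "z \<in> V" "x \<in> anc z" "y \<in> anc z"
  shows "x = y"
  using assms d_par[of x] d_par[of y] by (intro anc_depth_inj[OF assms(3-5)]) (auto simp: children_def)

lemma children_V: "x \<in> children w \<Longrightarrow> x \<in> V"
  by (simp add: children_def)

section \<open>The equality case: all vertices of \<open>W\<close> above a leaf belong to its
  leg\<close>

context
  assumes legs: "\<And>w a. w \<in> L \<Longrightarrow> a \<in> anc w - {c, v} \<Longrightarrow> choice a = w"
begin

text \<open>Two children of \<open>w\<close> would choose different leaves, and \<open>w\<close>
  would have to choose both of them.\<close>

lemma card_nbrs_W:
  assumes w: "w \<in> W"
  shows "card (nbrs E w) \<le> 2"
proof -
  have wV: "w \<in> V" "w \<noteq> c" "w \<noteq> v"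
    using w by (auto simp: W_def)
  have "x = y" if x: "x \<in> children w" and y: "y \<in> children w" for x y
  proof -
    note cx = choice[OF children_V[OF x]] and cy = choice[OF children_V[OF y]]
    have "w \<in> anc (choice x) - {c, v}" "w \<in> anc (choice y) - {c, v}"
      using wV cx(2) cy(2) anc_of_child[OF x] anc_of_child[OF y] anc_trans by blast+
    then have "choice x = choice y"
      using legs[OF cx(1), of w] legs[OF cy(1), of w] by simp
    then show ?thesis
      using sibling_eq[OF x y, of "choice x"] cx cy by (simp add: L_def)
  qed
  then have "card (children w) \<le> 1"
    unfolding One_nat_def card_le_Suc0_iff_eq[OF finite_children] by blast
  then show ?thesis
    using card_nbrs[OF wV(1,2)] by simp
qed

text \<open>Children of \<open>v\<close> choose leaves in \<open>B\<close>, and distinct children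
  choose distinct leaves.\<close>

lemma card_nbrs_v:
  assumes "card (L \<inter> B) \<le> 1"
  shows "card (nbrs E v) \<le> 2"
proof -
  have LB: "z = z'" if "z \<in> L \<inter> B" "z' \<in> L \<inter> B" for z z'
    using assms that finite_L card_le_Suc0_iff_eq[of "L \<inter> B"] by auto
  have "x = y" if x: "x \<in> children v" and y: "y \<in> children v" for x y
  proof -
    note cx = choice[OF children_V[OF x]] and cy = choice[OF children_V[OF y]]
    have "choice x \<in> L \<inter> B" "choice y \<in> L \<inter> B"
      using cx cy anc_of_child[OF x] anc_of_child[OF y] anc_trans by (auto simp: B_def L_def)
    then have "choice x = choice y"
      by (rule LB)
    then show ?thesis
      using sibling_eq[OF x y, of "choice x"] cx cy by (simp add: L_def)
  qed
  then have "card (children v) \<le> 1"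
    unfolding One_nat_def card_le_Suc0_iff_eq[OF finite_children] by blast
  then show ?thesis
    using card_nbrs[OF v_V v_neq] by simp
qed

text \<open>Same argument at \<open>c\<close>, apart from the child \<open>v\<close>, which leads to
  \<open>B\<close> and accounts for one further neighbour.\<close>

lemma card_nbrs_c:
  assumes "card (L - B) \<le> 1"
  shows "card (nbrs E c) \<le> 2"
proof -
  have LB: "z = z'" if "z \<in> L - B" "z' \<in> L - B" for z z'
    using assms that finite_L card_le_Suc0_iff_eq[of "L - B"] by auto
  have notB: "choice x \<in> L - B" if x: "x \<in> children c - {v}" for x
  proof -
    have xV: "x \<in> V" "x \<in> children c"
      using x by (auto simp: children_def)
    have "v \<notin> anc (choice x)"
      using sibling_eq[OF xV(2) v_child, of "choice x"] choice[OF xV(1)] x by (auto simp: L_def)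
    then show ?thesis
      using choice(1)[OF xV(1)] by (simp add: B_def)
  qed
  have "x = y" if x: "x \<in> children c - {v}" and y: "y \<in> children c - {v}" for x y
  proof -
    have xV: "x \<in> V" "x \<in> children c" and yV: "y \<in> V" "y \<in> children c"
      using x y by (auto simp: children_def)
    have "choice x = choice y"
      using LB[OF notB[OF x] notB[OF y]] .
    then show ?thesis
      using sibling_eq[OF xV(2) yV(2), of "choice x"] choice[OF xV(1)] choice[OF yV(1)]
      by (simp add: L_def)
  qed
  then have "card (children c - {v}) \<le> 1"
    using finite_children[of c] card_le_Suc0_iff_eq[of "children c - {v}"] by auto
  then show ?thesis
    using card_nbrs_root v_child finite_children[of c] by (simp add: card_Diff_singleton)
qed

end

lemma card_nbrs_v_ge: "2 \<le> card (nbrs E v)"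
  using children_v finite_children[of v] card_nbrs[OF v_V v_neq]
  by (simp add: Suc_le_eq card_gt_0_iff)

end

lemma critical_lambda_exists:
  fixes r :: nat
  assumes r: "1 \<le> r" and ls: "\<forall>l\<in>set ls. l \<le> r"
  obtains lam :: real where "0 < lam" "1 < lam * Suc r" "lam * r < 1"
    "(\<Sum>l\<leftarrow>Suc r # r # ls. 1 / (1 - lam * real l)) = 0"
proof -
  \<comment> \<open>At \<open>?a\<close> the term of the long leg has its pole. At
    \<open>?b\<close>, where \<open>1 / ?b = r + 1 / 2\<close>, the terms of the legs
    \<open>Suc r\<close> and \<open>r\<close> cancel, and only nonnegative terms remain.\<close>
  let ?a = "1 / (real r + 1)" and ?b = "2 / (2 * real r + 1)"
  define S where "S lam = (\<Sum>l\<leftarrow>ls. 1 / (1 - lam * real l))" for lam :: real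
  \<comment> \<open>The critical sum multiplied by \<open>lam * (r + 1) - 1\<close>, which removes
    the pole at \<open>?a\<close>; since \<open>f ?a = - 1\<close>, the root found is not
    \<open>?a\<close>.\<close>
  define f where "f lam = (lam * (real r + 1) - 1) * (1 / (1 - lam * r) + S lam) - 1" for lam :: real
  have ab: "?a \<le> ?b" and a: "0 < ?a" and b: "?b * r < 1"
    by (simp_all add: field_simps)
  have den: "lam * l < 1" if "0 \<le> lam" "lam \<le> ?b" "l \<le> r" for lam :: real and l :: nat
  proof -
    have "lam * l \<le> ?b * r"
      using that by (intro mult_mono) auto
    then show ?thesis
      using b by linarith
  qed
  have cont_S: "continuous_on {?a..?b} (\<lambda>lam. \<Sum>l\<leftarrow>xs. 1 / (1 - lam * real l))"
    if "\<forall>l\<in>set xs. l \<le> r" for xs :: "nat list"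
    using that
  proof (induction xs)
    case (Cons l xs)
    have "\<forall>lam\<in>{?a..?b}. 1 - lam * real l \<noteq> 0"
    proof
      fix lam assume "lam \<in> {?a..?b}"
      then have "lam * real l < 1"
        using den[of lam l] a Cons.prems by auto
      then show "1 - lam * real l \<noteq> 0"
        by simp
    qed
    then have "continuous_on {?a..?b} (\<lambda>lam. 1 / (1 - lam * real l))"
      by (intro continuous_intros)
    then show ?case
      using Cons by (auto intro!: continuous_on_add)
  qed simp
  have "continuous_on {?a..?b} (\<lambda>lam. \<Sum>l\<leftarrow>[r]. 1 / (1 - lam * real l))"
    by (rule cont_S) simp
  then have "continuous_on {?a..?b} f"
    unfolding f_def S_def using cont_S[OF ls]
    by (intro continuous_on_diff continuous_on_mult continuous_on_add continuous_on_id
        continuous_on_const) simp_all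
  moreover have fa: "f ?a = - 1"
    using a by (simp add: f_def)
  moreover have "0 \<le> f ?b"
  proof -
    have "0 \<le> S ?b"
      unfolding S_def using den[of ?b] ls by (intro sum_list_nonneg) (auto intro: less_imp_le)
    moreover have "f ?b = S ?b / (2 * real r + 1)"
    proof -
      have e: "?b * (real r + 1) - 1 = 1 / (2 * real r + 1)" "1 - ?b * r = 1 / (2 * real r + 1)"
        by (simp_all add: field_simps)
      have "2 * real r + 1 \<noteq> 0"
        by linarith
      then show ?thesis
        unfolding f_def e by (simp add: field_simps)
    qed
    ultimately show ?thesis
      by simp
  qed
  ultimately obtain lam where lam: "?a \<le> lam" "lam \<le> ?b" "f lam = 0"
    using IVT'[of f ?a 0 ?b] ab by auto
  have "lam \<noteq> ?a"
    using fa lam(3) by auto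
  then have "?a < lam"
    using lam(1) by simp
  then have gt: "1 < lam * (real r + 1)"
    by (simp add: field_simps)
  show thesis
  proof (rule that[of lam])
    show "0 < lam"
      using a lam(1) by linarith
    show "1 < lam * Suc r"
      using gt by (simp add: add.commute)
    show "lam * r < 1"
      using den[of lam r] lam a by simp
    have "1 / (1 - lam * r) + S lam = 1 / (lam * (real r + 1) - 1)"
      using lam(3) gt by (simp add: f_def eq_divide_eq mult.commute)
    moreover have "1 / (1 - lam * real (Suc r)) = - (1 / (lam * (real r + 1) - 1))"
      by (metis add.commute minus_diff_eq minus_divide_right of_nat_Suc)
    ultimately show "(\<Sum>l\<leftarrow>Suc r # r # ls. 1 / (1 - lam * real l)) = 0"
      by (simp add: S_def[symmetric] del: of_nat_Suc)
  qed
qed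

theorem ex_better_spider:
  fixes T :: "'a pair_pre_digraph"
  assumes T: "tree_graph T" and diam: "graph_diam T = 2 * r + 1" and r: "1 \<le> r"
    and not_spider: "\<not> spider T"
  shows "\<exists>S :: 'a pair_pre_digraph. spider S \<and> tree_graph S \<and> card (pverts S) = card (pverts T) \<and>
    graph_diam S = 2 * r + 1 \<and> steklov_lambda2 T < steklov_lambda2 S"
proof -
  obtain c par d v p q where R: "rooted (pverts T) (parcs T) c par d"
    and ax: "v \<in> rooted.children (pverts T) c par c"
    "p \<in> pverts T" "v \<notin> rooted.anc par p" "d p = r"
    "q \<in> pverts T" "v \<in> rooted.anc par q" "d q = Suc r"
    "\<And>w. w \<in> pverts T \<Longrightarrow> v \<notin> rooted.anc par w \<Longrightarrow> d w \<le> r"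
    "\<And>w. w \<in> pverts T \<Longrightarrow> v \<in> rooted.anc par w \<Longrightarrow> d w \<le> Suc r"
    using ex_central_edge[OF T diam] by metis
  interpret centred "pverts T" "parcs T" c par d v p q r
    using R r ax by (simp add: centred_def centred_axioms_def)
  have leaves: "leaves T = L"
    by (simp add: leaves_eq L_def)
  have pq: "p \<noteq> q"
    using p_B q_B by auto
  have fin: "finite (L - {p, q})"
    using finite_L by simp
  obtain xs where xs: "set xs = L - {p, q}" "distinct xs"
    using finite_distinct_list[OF fin] by blast
  \<comment> \<open>The legs of \<open>p\<close> and \<open>q\<close> both have length
    \<open>r\<close>; they become the entries \<open>Suc r\<close> and \<open>r\<close>, the former
    after adding the central edge.\<close>
  define ls where "ls = map leg xs"
  have ls: "\<forall>l\<in>set ls. 1 \<le> l \<and> l \<le> r"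
    using leg_ge leg_le xs by (auto simp: ls_def L_def)
  have sum_legs: "sum_list ls + 2 * r = card (pverts T) - 2"
  proof -
    have "sum_list ls = (\<Sum>w\<in>L - {p, q}. leg w)"
      using xs by (simp add: ls_def sum_list_distinct_conv_sum_set)
    moreover have "(\<Sum>w\<in>L. leg w) = leg p + (leg q + (\<Sum>w\<in>L - {p} - {q}. leg w))"
      using finite_L p_L q_L pq by (simp add: sum.remove[of L p] sum.remove[of "L - {p}" q])
    moreover have "L - {p} - {q} = L - {p, q}"
      by blast
    ultimately show ?thesis
      using sum_leg leg_p leg_q by simp
  qed
  have card_ge: "2 \<le> card (pverts T)"
    using card_mono[OF finV, of "{c, v}"] cV v_V v_neq by simp
  obtain lam :: real where lam: "0 < lam" "1 < lam * Suc r" "lam * r < 1"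
    and crit: "(\<Sum>l\<leftarrow>Suc r # r # ls. 1 / (1 - lam * real l)) = 0"
    using critical_lambda_exists[OF r, of ls] ls by blast
  have "card (pverts T) = Suc (sum_list (Suc r # r # ls))"
    using sum_legs card_ge by simp
  then obtain S :: "'a pair_pre_digraph" where S: "spider S" "tree_graph S" "card (pverts S) = card (pverts T)"
    "graph_diam S = 2 * r + 1" "lam \<le> steklov_lambda2 S"
    using ex_spider_lambda2_ge[OF finV _ r ls lam crit] by blast
  define F G where "F = (\<Sum>w\<in>L - B. slope lam w)" and "G = (\<Sum>w\<in>L \<inter> B. slope lam w)"
  define \<phi> where "\<phi> = lam / (1 - lam * r)"
  have slope_pq: "slope lam p = \<phi>" "slope lam q = \<phi>"
    using lam by (simp_all add: slope_def leg_p leg_q \<phi>_def)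
  have slope_pos': "0 < slope lam w" if "w \<in> L" for w
    using slope_pos[OF lam(1,3)] that by (simp add: L_def)
  have \<phi>: "\<phi> > 0"
    using lam by (simp add: \<phi>_def)
  have F: "F = \<phi> + (\<Sum>w\<in>L - B - {p}. slope lam w)"
    unfolding F_def using finite_L p_L p_B slope_pq by (subst sum.remove[of _ p]) auto
  have G: "G = \<phi> + (\<Sum>w\<in>L \<inter> B - {q}. slope lam w)"
    unfolding G_def using finite_L q_L q_B slope_pq by (subst sum.remove[of _ q]) auto
  have Fge: "0 \<le> F - \<phi>" "0 \<le> G - \<phi>"
  proof -
    have "0 \<le> (\<Sum>w\<in>A. slope lam w)" if "A \<subseteq> L" for A
      using slope_pos' that by (intro sum_nonneg less_imp_le) blast
    from this[of "L - B - {p}"] this[of "L \<inter> B - {q}"] show "0 \<le> F - \<phi>" "0 \<le> G - \<phi>"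
      using F G by auto
  qed
  \<comment> \<open>Total rate of the legs of the spider apart from the prolonged one; the critical
    equation determines it from \<open>lam\<close> and \<open>r\<close> alone.\<close>
  define X where "X = F + G - \<phi>"
  have X: "X = lam / (lam * Suc r - 1)"
  proof -
    have "F + G = (\<Sum>w\<in>L. slope lam w)"
      unfolding F_def G_def using sum.Int_Diff[OF finite_L, of "slope lam" B] by simp
    also have "\<dots> = slope lam p + (slope lam q + (\<Sum>w\<in>L - {p} - {q}. slope lam w))"
      using finite_L p_L q_L pq by (simp add: sum.remove[of L p] sum.remove[of "L - {p}" q])
    also have "L - {p} - {q} = L - {p, q}"
      by blast
    finally have "X = \<phi> + (\<Sum>w\<in>L - {p, q}. slope lam w)"
      by (simp add: X_def slope_pq)
    also have "(\<Sum>w\<in>L - {p, q}. slope lam w) = lam * (\<Sum>l\<leftarrow>ls. 1 / (1 - lam * real l))"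
      using xs lam by (simp add: ls_def slope_def sum_list_distinct_conv_sum_set o_def
          sum_distrib_left)
    finally have "X = lam * (1 / (1 - lam * r) + (\<Sum>l\<leftarrow>ls. 1 / (1 - lam * real l)))"
      by (simp add: \<phi>_def distrib_left)
    also have "1 / (1 - lam * r) + (\<Sum>l\<leftarrow>ls. 1 / (1 - lam * real l)) = - (1 / (1 - lam * Suc r))"
      using crit by (simp del: of_nat_Suc)
    also have "- (1 / (1 - lam * Suc r)) = 1 / (lam * Suc r - 1)"
      by (metis minus_diff_eq minus_divide_right)
    finally show ?thesis
      by simp
  qed
  \<comment> \<open>Indeed \<open>1 / \<phi> = 1 / lam - r\<close> and
    \<open>1 / X = r + 1 - 1 / lam\<close> add up to 1.\<close>
  have "\<phi> * X = \<phi> + X"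
    using lam unfolding \<phi>_def X by (simp add: divide_simps) algebra
  then have FG: "F * G - (F + G) = (F - \<phi>) * (G - \<phi>)"
    by (simp add: X_def algebra_simps)
  then have FG_le: "F + G \<le> F * G"
    using Fge by (metis diff_ge_0_iff_ge mult_nonneg_nonneg)
  have strict: "F + G < F * G \<or> (\<exists>w\<in>L. \<exists>a\<in>anc w - {c, v}. choice a \<noteq> w)"
  proof (rule ccontr)
    assume "\<not> ?thesis"
    then have "\<not> 0 < (F - \<phi>) * (G - \<phi>)" and legs: "\<And>w a. w \<in> L \<Longrightarrow> a \<in> anc w - {c, v} \<Longrightarrow> choice a = w"
      using FG by auto
    then have "F - \<phi> \<le> 0 \<or> G - \<phi> \<le> 0"
      by (meson mult_pos_pos not_le)
    then show False
    proof
      assume "F - \<phi> \<le> 0"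
      \<comment> \<open>All slopes are positive, so \<open>F = \<phi>\<close> leaves no leaf besides
        \<open>p\<close> on the side of \<open>c\<close>.\<close>
      then have "\<not> (\<exists>w. w \<in> L - B - {p})"
        using F sum_pos2[of "L - B - {p}" _ "slope lam"] finite_L slope_pos' by (force intro: less_imp_le)
      then have "L - B \<subseteq> {p}"
        by auto
      then have "card (L - B) \<le> 1"
        using card_mono[of "{p}" "L - B"] by simp
      \<comment> \<open>Now \<open>v\<close> is the only vertex that can have degree above 2, so it
        is the centre; in the other case it is \<open>c\<close>.\<close>
      from card_nbrs_c[OF legs this] have "spider T"
        using card_nbrs_v_ge v_V card_nbrs_W[OF legs]
        by (intro spiderI[OF T, of v]) (auto simp: W_def)
      then show False
        using not_spider by blast
    next
      assume "G - \<phi> \<le> 0"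
      then have "\<not> (\<exists>w. w \<in> L \<inter> B - {q})"
        using G sum_pos2[of "L \<inter> B - {q}" _ "slope lam"] finite_L slope_pos' by (force intro: less_imp_le)
      then have "L \<inter> B \<subseteq> {q}"
        by auto
      then have "card (L \<inter> B) \<le> 1"
        using card_mono[of "{q}" "L \<inter> B"] by simp
      from card_nbrs_v[OF legs this] have "spider T"
        using nbrs_c_ge cV card_nbrs_W[OF legs]
        by (intro spiderI[OF T, of c]) (auto simp: W_def)
      then show False
        using not_spider by blast
    qed
  qed
  obtain h where h: "(\<Sum>w\<in>L. h w) = 0" "0 < (\<Sum>w\<in>L. (h w)\<^sup>2)" "energy (parcs T) h < lam * (\<Sum>w\<in>L. (h w)\<^sup>2)"
    using ex_test[OF lam(1,3) F_def G_def FG_le strict] by blast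
  have bg: "boundary_graph (pverts T) (leaves T) (parcs T)"
    using rooted_boundary_graph[OF R] p_L card_ge leaves by blast
  have "steklov_lambda2 T * (\<Sum>w\<in>L. (h w)\<^sup>2) \<le> energy (parcs T) h"
    using steklov_lambda2_min(1)[OF bg, of p q h] h(1) p_L q_L pq by (simp add: leaves)
  then have "steklov_lambda2 T * (\<Sum>w\<in>L. (h w)\<^sup>2) < lam * (\<Sum>w\<in>L. (h w)\<^sup>2)"
    using h(3) by simp
  then have "steklov_lambda2 T < lam"
    using h(2) by simp
  then show ?thesis
    using S by (intro exI[of _ S]) simp
qed

theorem theorem1p3:
  fixes r D n :: nat
  assumes "D = 2 * r + 1" and "D \<ge> 3" and "n \<ge> D + 1"
  shows
    "(\<forall>T :: 'a pair_pre_digraph.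
        tree_graph T \<and> card (pverts T) = n \<and> graph_diam T = D \<longrightarrow>
        (\<exists>D\<^sub>T :: 'a pair_pre_digraph.
           double_spider D\<^sub>T \<and> card (pverts D\<^sub>T) = n \<and> graph_diam D\<^sub>T = D \<and>
           steklov_lambda2 T \<le> steklov_lambda2 D\<^sub>T \<and>
           (steklov_lambda2 T = steklov_lambda2 D\<^sub>T \<longrightarrow> double_spider T))) \<and>
     (\<forall>S :: 'a pair_pre_digraph. double_spider S \<and> maximizes_lambda2 n D S \<longrightarrow> spider S) \<and>
     (\<forall>T :: 'a pair_pre_digraph. maximizes_lambda2 n D T \<longrightarrow> spider T)"
proof -
  have r: "1 \<le> r"
    using assms by simp
  have better: "\<exists>S :: 'a pair_pre_digraph. spider S \<and> tree_graph S \<and> card (pverts S) = n \<and>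
      graph_diam S = D \<and> steklov_lambda2 T < steklov_lambda2 S"
    if "tree_graph T" "card (pverts T) = n" "graph_diam T = D" "\<not> spider T"
    for T :: "'a pair_pre_digraph"
    using ex_better_spider[OF that(1) _ r that(4)] that(2,3) assms(1) by simp
  have "\<exists>D\<^sub>T :: 'a pair_pre_digraph.
      double_spider D\<^sub>T \<and> card (pverts D\<^sub>T) = n \<and> graph_diam D\<^sub>T = D \<and>
      steklov_lambda2 T \<le> steklov_lambda2 D\<^sub>T \<and>
      (steklov_lambda2 T = steklov_lambda2 D\<^sub>T \<longrightarrow> double_spider T)"
    if T: "tree_graph T" "card (pverts T) = n" "graph_diam T = D" for T :: "'a pair_pre_digraph"
  proof (cases "spider T")
    case True
    then have "double_spider T"
      using spider_imp_double_spider assms(2) T(3) by blast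
    then show ?thesis
      \<comment> \<open>A spider serves as its own comparison tree.\<close>
      using T by (intro exI[of _ T]) simp
  next
    case False
    obtain S :: "'a pair_pre_digraph" where S: "spider S" "card (pverts S) = n" "graph_diam S = D"
      "steklov_lambda2 T < steklov_lambda2 S"
      using better[OF T False] by blast
    then have "double_spider S"
      using spider_imp_double_spider assms(2) by blast
    \<comment> \<open>The inequality is strict, so the clause about equality holds
      vacuously.\<close>
    then show ?thesis
      using S by (intro exI[of _ S]) simp
  qed
  moreover have "spider T" if T: "maximizes_lambda2 n D T" for T :: "'a pair_pre_digraph"
  proof (rule ccontr)
    assume "\<not> spider T"
    moreover have "tree_graph T" "card (pverts T) = n" "graph_diam T = D"
      using T by (auto simp: maximizes_lambda2_def trees_with_def)
    ultimately obtain S :: "'a pair_pre_digraph" where "S \<in> trees_with n D"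
      "steklov_lambda2 T < steklov_lambda2 S"
      using better[of T] by (auto simp: trees_with_def)
    then show False
      using T by (auto simp: maximizes_lambda2_def not_le[symmetric])
  qed
  ultimately show ?thesis
    by blast
qed

end
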